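(* Let $V$ be a subgroup of $\mathcal{L}_n$ with triple $(s,V_0,v)$. Then $V$ is weakly maximal if and only if either $s=0$ and $V_0=\mathcal{A}_n$, or $s>0$ and the factor module $\mathcal{A}_n^s/V_0$ is isomorphic to $R$ as an $R$-module. Such a weakly maximal subgroup $V$ is closed in the pro-$p$ topology of $\mathcal{L}_n$ if and only if $s=0$ or $s$ is a power of $p$.
   Context: $p$ is a fixed prime, $n\ge 1$, $R=\mathbb{F}_p[x,x^{-1}]$. $\mathcal{A}_n=\bigoplus_{\mathbb{Z}}(\mathbb{Z}/p\mathbb{Z})^n$ is identified with the additive group of $R^n$, so that the shift by one on $\mathcal{A}_n$ is multiplication by $x$. $\mathcal{L}_n=(\mathbb{Z}/p\mathbb{Z})^n\wr\mathbb{Z}=\mathcal{A}_n\rtimes\mathbb{Z}$, with elements written $(v,s)$ and multiplication $(v,s)(w,t)=(v+x^sw,s+t)$; $\mathcal{A}_n$ is identified with $\{(v,0)\}$. The triple $(s,V_0,v)$ of a subgroup $V\le\mathcal{L}_n$: $s\ge 0$ is the integer such that $s\mathbb{Z}$ is the image of $V$ under the projection to $\mathbb{Z}$, $V_0=V\cap\mathcal{A}_n$ (it satisfies $x^sV_0=V_0$), and $v\in\mathcal{A}_n$ is any element with $(v,s)\in V$ (well defined modulo $V_0$; for $s=0$ one takes $v=0$). For $s>0$, $\mathcal{A}_n^s$ denotes $\mathcal{A}_n$ with the $R$-module structure in which $x$ acts by $x*v=x^sv$ (it is isomorphic to $R^{ns}$); $V_0$ is an $R$-submodule of $\mathcal{A}_n^s$.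 A subgroup $H$ of a group $G$ is weakly maximal if it has infinite index in $G$ but every subgroup of $G$ properly containing $H$ has finite index in $G$. A subgroup $H\le G$ is closed in the pro-$p$ topology if it is closed for the topology on $G$ with basis of neighbourhoods of $1$ the normal subgroups of $G$ of index a power of $p$. Powers of $p$ include $p^0=1$. *)

theory Defs
  imports
    "HOL-Algebra.Coset"
    "HOL-Algebra.AbelCoset"
    "HOL-Algebra.Module"
    "HOL-Library.Poly_Mapping"
    "HOL-Analysis.Finite_Cartesian_Product"
    "HOL-Analysis.Abstract_Topology"
    "Berlekamp_Zassenhaus.Finite_Field"
begin

section \<open>Weakly maximal subgroups and the pro-p topology\<close>

definition finite_index :: "('a, 'm) monoid_scheme \<Rightarrow> 'a set \<Rightarrow> bool" where
  "finite_index G H \<longleftrightarrow> finite (rcosets\<^bsub>G\<^esub> H)"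

definition weakly_maximal :: "('a, 'm) monoid_scheme \<Rightarrow> 'a set \<Rightarrow> bool" where
  "weakly_maximal G H \<longleftrightarrow>
     subgroup H G \<and> \<not> finite_index G H \<and> (\<forall>K. subgroup K G \<and> H \<subset> K \<longrightarrow> finite_index G K)"

text \<open>The index is the cardinality of the set of cosets.  For \<open>p > 0\<close> the equation below forces
  this set to be finite, because infinite sets have \<^const>\<open>card\<close> equal to 0.\<close>

definition normal_p_power_index :: "nat \<Rightarrow> ('a, 'm) monoid_scheme \<Rightarrow> 'a set \<Rightarrow> bool" where
  "normal_p_power_index p G N \<longleftrightarrow> N \<lhd> G \<and> (\<exists>k. card (rcosets\<^bsub>G\<^esub> N) = p ^ k)"

definition pro_p_open :: "nat \<Rightarrow> ('a, 'm) monoid_scheme \<Rightarrow> 'a set \<Rightarrow> bool" where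
  "pro_p_open p G U \<longleftrightarrow>
     U \<subseteq> carrier G \<and> (\<forall>g\<in>U. \<exists>N. normal_p_power_index p G N \<and> g <#\<^bsub>G\<^esub> N \<subseteq> U)"

definition pro_p_topology :: "nat \<Rightarrow> ('a, 'm) monoid_scheme \<Rightarrow> 'a topology" where
  "pro_p_topology p G = topology (pro_p_open p G)"

lemma normal_p_power_index_Int:
  assumes p: "prime p" and G: "group G"
    and N: "normal_p_power_index p G N" and M: "normal_p_power_index p G M"
  shows "normal_p_power_index p G (N \<inter> M)"
proof -
  interpret group G by fact
  interpret N: normal N G using N by (simp add: normal_p_power_index_def)
  interpret M: normal M G using M by (simp add: normal_p_power_index_def)
  obtain a b where a: "card (rcosets\<^bsub>G\<^esub> N) = p ^ a" and b: "card (rcosets\<^bsub>G\<^esub> M) = p ^ b"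
    using N M by (auto simp: normal_p_power_index_def)
  define P where "P = (G Mod N) \<times>\<times> (G Mod M)"
  define h where "h = (\<lambda>g. (N #>\<^bsub>G\<^esub> g, M #>\<^bsub>G\<^esub> g))"
  have gP: "group P"
    unfolding P_def by (intro DirProd_group N.factorgroup_is_group M.factorgroup_is_group)
  have "h \<in> hom G P"
    unfolding P_def h_def hom_def
    by (auto simp: FactGroup_def RCOSETS_def N.rcos_sum M.rcos_sum)
  then interpret h: group_hom G P h
    using gP is_group by (simp add: group_hom_def group_hom_axioms_def)
  have ker: "kernel G P h = N \<inter> M"
  proof
    show "kernel G P h \<subseteq> N \<inter> M"
      using coset_join1[OF _ _ N.subgroup_axioms] coset_join1[OF _ _ M.subgroup_axioms]
      by (auto simp: kernel_def h_def P_def FactGroup_def N.subset M.subset)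
    show "N \<inter> M \<subseteq> kernel G P h"
      using N.subset M.subset N.rcos_const M.rcos_const
      by (auto simp: kernel_def h_def P_def FactGroup_def)
  qed
  have nNM: "N \<inter> M \<lhd> G"
    using h.normal_kernel ker by simp
  interpret img: subgroup "h ` carrier G" P
    by (rule h.img_is_subgroup)
  have carP: "carrier P = (rcosets\<^bsub>G\<^esub> N) \<times> (rcosets\<^bsub>G\<^esub> M)"
    by (simp add: P_def FactGroup_def)
  have "card (h ` carrier G) dvd Coset.order P"
    using group.lagrange[OF gP h.img_is_subgroup] by (metis dvd_triv_right)
  moreover have "Coset.order P = p ^ (a + b)"
    unfolding Coset.order_def carP card_cartesian_product a b power_add ..
  ultimately obtain k where k: "card (h ` carrier G) = p ^ k"
    using divides_primepow_nat[OF p] by auto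
  have "group_hom G (P\<lparr>carrier := h ` carrier G\<rparr>) h"
    using img.subgroup_is_group[OF gP] h.homh is_group
    by (auto simp: group_hom_def group_hom_axioms_def hom_def)
  from group_hom.FactGroup_iso[OF this]
  have "G Mod (N \<inter> M) \<cong> P\<lparr>carrier := h ` carrier G\<rparr>"
    using ker by (simp add: kernel_def)
  then have "card (rcosets\<^bsub>G\<^esub> (N \<inter> M)) = card (h ` carrier G)"
    using iso_same_card[of "G Mod (N \<inter> M)" "P\<lparr>carrier := h ` carrier G\<rparr>"]
    by (simp add: FactGroup_def)
  with nNM k show ?thesis by (auto simp: normal_p_power_index_def)
qed

lemma istopology_pro_p_open:
  assumes "prime p" "group G"
  shows "istopology (pro_p_open p G)"
  unfolding istopology_def
proof (intro conjI allI impI)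
  fix S T assume S: "pro_p_open p G S" and T: "pro_p_open p G T"
  show "pro_p_open p G (S \<inter> T)"
    unfolding pro_p_open_def
  proof (intro conjI ballI)
    show "S \<inter> T \<subseteq> carrier G" using S by (auto simp: pro_p_open_def)
    fix g assume g: "g \<in> S \<inter> T"
    then obtain N M where "normal_p_power_index p G N" "g <#\<^bsub>G\<^esub> N \<subseteq> S"
      "normal_p_power_index p G M" "g <#\<^bsub>G\<^esub> M \<subseteq> T"
      using S T unfolding pro_p_open_def by blast
    moreover have "g <#\<^bsub>G\<^esub> (N \<inter> M) \<subseteq> (g <#\<^bsub>G\<^esub> N) \<inter> (g <#\<^bsub>G\<^esub> M)"
      by (auto simp: l_coset_def)
    ultimately show "\<exists>K. normal_p_power_index p G K \<and> g <#\<^bsub>G\<^esub> K \<subseteq> S \<inter> T"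
      using normal_p_power_index_Int[OF assms] by blast
  qed
next
  fix \<K> assume "\<forall>K\<in>\<K>. pro_p_open p G K"
  then show "pro_p_open p G (\<Union>\<K>)"
    unfolding pro_p_open_def by (meson Sup_least Union_iff Union_upper order_trans)
qed

lemma openin_pro_p_topology:
  assumes "prime p" "group G"
  shows "openin (pro_p_topology p G) = pro_p_open p G"
  unfolding pro_p_topology_def by (rule topology_inverse'[OF istopology_pro_p_open[OF assms]])

lemma topspace_pro_p_topology:
  assumes "prime p" "group G"
  shows "topspace (pro_p_topology p G) = carrier G"
proof -
  interpret group G by fact
  have "rcosets\<^bsub>G\<^esub> (carrier G) = {carrier G}"
    using coset_join2[OF _ subgroup_self] by (auto simp: RCOSETS_def)
  then have "normal_p_power_index p G (carrier G)"
    by (auto simp: normal_p_power_index_def normal_inv_iff subgroup_self intro!: exI[of _ 0])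
  then have "pro_p_open p G (carrier G)"
    unfolding pro_p_open_def
    by (metis l_coset_subset_G order_refl)
  then show ?thesis
    unfolding topspace_def openin_pro_p_topology[OF assms] by (auto simp: pro_p_open_def)
qed


section \<open>Isomorphisms and factors of modules\<close>

definition module_iso :: "('r, 'k) ring_scheme \<Rightarrow> ('r, 'a) module \<Rightarrow> ('r, 'b) module \<Rightarrow> ('a \<Rightarrow> 'b) set" where
  "module_iso R M N = {h. bij_betw h (carrier M) (carrier N) \<and>
     (\<forall>x\<in>carrier M. \<forall>y\<in>carrier M. h (x \<oplus>\<^bsub>M\<^esub> y) = h x \<oplus>\<^bsub>N\<^esub> h y) \<and>
     (\<forall>r\<in>carrier R. \<forall>x\<in>carrier M. h (r \<odot>\<^bsub>M\<^esub> x) = r \<odot>\<^bsub>N\<^esub> h x)}"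

definition module_isomorphic :: "('r, 'k) ring_scheme \<Rightarrow> ('r, 'a) module \<Rightarrow> ('r, 'b) module \<Rightarrow> bool" where
  "module_isomorphic R M N \<longleftrightarrow> module_iso R M N \<noteq> {}"

text \<open>For a submodule \<open>N\<close>, scalar multiplication of cosets is \<open>r \<odot> (N + x) = N + r \<odot> x\<close>.  The fields \<open>mult\<close> and \<open>one\<close> of a module record
  have no meaning for a module and are left unspecified.\<close>

definition factor_module :: "('r, 'a) module \<Rightarrow> 'a set \<Rightarrow> ('r, 'a set) module" where
  "factor_module M N =
     \<lparr>carrier = a_rcosets\<^bsub>M\<^esub> N, monoid.mult = undefined, one = undefined,
      zero = N, add = set_add M,
      module.smult = (\<lambda>r X. \<Union>x\<in>X. N +>\<^bsub>M\<^esub> (r \<odot>\<^bsub>M\<^esub> x))\<rparr>"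

lemma smult_factor_module:
  assumes "module R M" "submodule N R M" and r: "r \<in> carrier R" and x: "x \<in> carrier M"
  shows "r \<odot>\<^bsub>factor_module M N\<^esub> (N +>\<^bsub>M\<^esub> x) = N +>\<^bsub>M\<^esub> (r \<odot>\<^bsub>M\<^esub> x)"
proof -
  interpret module R M by fact
  interpret N: submodule N R M by fact
  interpret A: abelian_subgroup N M
    using N.subgroup_axioms M.abelian_group_axioms
    by (intro abelian_subgroupI3) (simp_all add: additive_subgroup_def)
  have "N +>\<^bsub>M\<^esub> (r \<odot>\<^bsub>M\<^esub> y) = N +>\<^bsub>M\<^esub> (r \<odot>\<^bsub>M\<^esub> x)" if "y \<in> N +>\<^bsub>M\<^esub> x" for y
  proof -
    from that obtain h where h: "h \<in> N" and y: "y = h \<oplus>\<^bsub>M\<^esub> x"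
      by (auto simp: a_r_coset_def')
    have "r \<odot>\<^bsub>M\<^esub> y = r \<odot>\<^bsub>M\<^esub> h \<oplus>\<^bsub>M\<^esub> r \<odot>\<^bsub>M\<^esub> x"
      using h x r A.a_subset by (auto simp: y smult_r_distr)
    then have "r \<odot>\<^bsub>M\<^esub> y \<in> N +>\<^bsub>M\<^esub> (r \<odot>\<^bsub>M\<^esub> x)"
      using N.smult_closed[OF r h] by (auto simp: a_r_coset_def')
    then show ?thesis
      by (intro A.a_repr_independence'[symmetric] smult_closed r x)
  qed
  moreover have "x \<in> N +>\<^bsub>M\<^esub> x"
    using A.a_rcos_self[OF x] .
  ultimately have "(\<Union>y\<in>N +>\<^bsub>M\<^esub> x. N +>\<^bsub>M\<^esub> (r \<odot>\<^bsub>M\<^esub> y)) = N +>\<^bsub>M\<^esub> (r \<odot>\<^bsub>M\<^esub> x)"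
    by blast
  then show ?thesis
    by (simp add: factor_module_def)
qed


section \<open>Laurent polynomials and the lamplighter group\<close>

text \<open>The prime \<open>p\<close> is \<open>CARD('p)\<close> for a type \<open>'p\<close> of class \<^class>\<open>prime_card\<close>, the number \<open>n\<close> is
  \<open>CARD('n)\<close>, and \<open>\<F>\<^sub>p\<close> is \<open>'p mod_ring\<close>.  Finitely supported functions on \<open>\<int>\<close>, with
  convolution as product, are the Laurent polynomials: \<open>x\<^sup>i\<close> is \<open>Poly_Mapping.single i 1\<close>.\<close>

type_synonym 'p laurent = "int \<Rightarrow>\<^sub>0 'p mod_ring"

definition X_pow :: "int \<Rightarrow> 'p::prime_card laurent" where
  "X_pow i = Poly_Mapping.single i 1"

definition laurent_ring :: "'p::prime_card laurent ring" where
  "laurent_ring = \<lparr>carrier = UNIV, monoid.mult = (*), one = 1, zero = 0, add = (+)\<rparr>"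

definition laurent_module :: "('p::prime_card laurent, 'p laurent) module" where
  "laurent_module =
     \<lparr>carrier = UNIV, monoid.mult = (*), one = 1, zero = 0, add = (+), module.smult = (*)\<rparr>"

definition lamplighter :: "((('p::prime_card laurent) ^ 'n) \<times> int) monoid" where
  "lamplighter =
     \<lparr>carrier = UNIV,
      monoid.mult = (\<lambda>(v, s) (w, t). (v + X_pow s *s w, s + t)),
      one = (0, 0)\<rparr>"

definition triple ::
  "((('p::prime_card laurent) ^ 'n) \<times> int) set \<Rightarrow> nat \<Rightarrow> ('p laurent ^ 'n) set \<Rightarrow> 'p laurent ^ 'n \<Rightarrow> bool" where
  "triple V s V0 v \<longleftrightarrow>
     snd ` V = {int s * k |k. True} \<and> V0 = {a. (a, 0) \<in> V} \<and> (v, int s) \<in> V \<and> (s = 0 \<longrightarrow> v = 0)"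

text \<open>The substitution \<open>f(x) \<mapsto> f(x\<^sup>s)\<close>.\<close>

definition subst_X_pow :: "nat \<Rightarrow> 'p::prime_card laurent \<Rightarrow> 'p laurent" where
  "subst_X_pow s f =
     (\<Sum>i\<in>Poly_Mapping.keys f. Poly_Mapping.single (int s * i) (Poly_Mapping.lookup f i))"

text \<open>\<open>R\<^sup>n\<close> with \<open>x\<close> acting as multiplication by \<open>x\<^sup>s\<close>, so that \<open>f\<close> acts as
  multiplication by \<open>f(x\<^sup>s)\<close>.\<close>

definition lamp_module :: "nat \<Rightarrow> ('p::prime_card laurent, 'p laurent ^ 'n) module" where
  "lamp_module s =
     \<lparr>carrier = UNIV, monoid.mult = undefined, one = undefined, zero = 0, add = (+),
      module.smult = (\<lambda>f v. subst_X_pow s f *s v)\<rparr>"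

lemma group_lamplighter: "group lamplighter"
proof (rule groupI)
  fix a :: "(('a::prime_card laurent) ^ 'b) \<times> int"
  show "\<exists>b\<in>carrier lamplighter. b \<otimes>\<^bsub>lamplighter\<^esub> a = \<one>\<^bsub>lamplighter\<^esub>"
    by (rule bexI[of _ "(X_pow (- snd a) *s (- fst a), - snd a)"])
      (auto simp: lamplighter_def vec_eq_iff split: prod.splits)
qed (auto simp: lamplighter_def X_pow_def vec_eq_iff algebra_simps mult_single
      simp flip: mult.assoc single_one split: prod.splits)

lemma cring_laurent_ring: "cring laurent_ring"
proof (rule cringI)
  show "abelian_group laurent_ring"
    by (rule abelian_groupI)
      (auto simp: laurent_ring_def algebra_simps intro!: exI[of _ "- x" for x])
qed (auto intro!: comm_monoidI simp: laurent_ring_def algebra_simps)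

lemma subst_X_pow_superset:
  assumes "finite A" "Poly_Mapping.keys f \<subseteq> A"
  shows "subst_X_pow s f =
    (\<Sum>i\<in>A. Poly_Mapping.single (int s * i) (Poly_Mapping.lookup f i))"
  unfolding subst_X_pow_def using assms
  by (intro sum.mono_neutral_left) (auto simp: in_keys_iff)

lemma subst_X_pow_single [simp]:
  "subst_X_pow s (Poly_Mapping.single i c) = Poly_Mapping.single (int s * i) c"
  by (subst subst_X_pow_superset[of "{i}"]) auto

lemma subst_X_pow_add: "subst_X_pow s (f + g) = subst_X_pow s f + subst_X_pow s g"
proof -
  let ?A = "Poly_Mapping.keys f \<union> Poly_Mapping.keys g"
  have "Poly_Mapping.keys (f + g) \<subseteq> ?A" by (rule Poly_Mapping.keys_add)
  then show ?thesis
    by (simp add: subst_X_pow_superset[of ?A] lookup_add single_add sum.distrib)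
qed

lemma subst_X_pow_zero [simp]: "subst_X_pow s 0 = 0"
  by (simp add: subst_X_pow_def)

lemma sum_single_lookup:
  "(\<Sum>i\<in>Poly_Mapping.keys f. Poly_Mapping.single i (Poly_Mapping.lookup f i)) = f"
  by (rule poly_mapping_eqI) (auto simp: lookup_sum lookup_single when_def in_keys_iff)

lemma laurent_induct:
  assumes "P 0" and "\<And>f i c. P f \<Longrightarrow> P (f + Poly_Mapping.single i c)"
  shows "P (f :: 'p::prime_card laurent)"
proof -
  have "P (\<Sum>i\<in>A. Poly_Mapping.single i (Poly_Mapping.lookup f i))" if "finite A" for A
    using that
  proof (induction A rule: finite_induct)
    case (insert i A)
    then show ?case
      using assms(2)[OF insert.IH] by (simp add: add.commute)
  qed (use assms(1) in simp)
  from this[of "Poly_Mapping.keys f"] show ?thesis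
    by (simp add: sum_single_lookup)
qed

lemma subst_X_pow_mult: "subst_X_pow s (f * g) = subst_X_pow s f * subst_X_pow s g"
proof (induction f rule: laurent_induct)
  case (2 f i c)
  have "subst_X_pow s (Poly_Mapping.single i c * g) = Poly_Mapping.single (int s * i) c * subst_X_pow s g"
    by (induction g rule: laurent_induct)
      (simp_all add: distrib_left subst_X_pow_add mult_single)
  with 2 show ?case
    by (simp add: distrib_right subst_X_pow_add)
qed simp

lemma module_lamp_module: "module laurent_ring (lamp_module s)"
proof (rule moduleI[OF cring_laurent_ring])
  show "abelian_group (lamp_module s :: ('a::prime_card laurent, 'a laurent ^ 'b) module)"
    by (rule abelian_groupI)
      (auto simp: lamp_module_def algebra_simps intro!: exI[of _ "- x" for x])
qed (auto simp: lamp_module_def laurent_ring_def subst_X_pow_add subst_X_pow_mult vec_eq_iff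
      algebra_simps simp flip: single_one)

lemma X_acts_on_lamp_module: "X_pow 1 \<odot>\<^bsub>lamp_module s\<^esub> v = X_pow (int s) *s v"
  by (simp add: lamp_module_def X_pow_def)

lemma submodule_triple:
  assumes V: "subgroup V lamplighter" and t: "triple V s V0 v"
  shows "submodule V0 laurent_ring (lamp_module s)"
proof -
  interpret L: group "lamplighter :: ((('a::prime_card laurent) ^ 'b) \<times> int) monoid"
    by (rule group_lamplighter)
  interpret V: subgroup V lamplighter by fact
  have V0: "a \<in> V0 \<longleftrightarrow> (a, 0) \<in> V" for a
    using t by (auto simp: triple_def)
  have v: "(v, int s) \<in> V" using t by (simp add: triple_def)
  have one: "X_pow 0 *s a = a" for a :: "'a laurent ^ 'b"
    by (simp add: X_pow_def)
  have minus_vec: "r *s (- a) = - (r *s a)" for r and a :: "'a laurent ^ 'b"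
    by (simp add: vec_eq_iff)
  have X: "X_pow i *s (X_pow j *s a) = X_pow (i + j) *s a" for i j and a :: "'a laurent ^ 'b"
    by (simp add: X_pow_def vec_eq_iff mult_single mult.assoc [symmetric])
  have zero: "0 \<in> V0"
    using V.one_closed by (simp add: V0 lamplighter_def)
  have add: "a + b \<in> V0" if "a \<in> V0" "b \<in> V0" for a b
    using V.m_closed[of "(a, 0)" "(b, 0)"] that by (simp add: V0 lamplighter_def one)
  have inv: "inv\<^bsub>lamplighter\<^esub> (a, i) = (- (X_pow (- i) *s a), - i)" for a :: "'a laurent ^ 'b" and i
    by (rule L.inv_equality) (simp_all add: lamplighter_def)
  have neg: "- a \<in> V0" if "a \<in> V0" for a
    using V.m_inv_closed[of "(a, 0)"] that by (simp add: V0 inv one)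
  have up: "X_pow (int s) *s a \<in> V0" if "a \<in> V0" for a
  proof -
    have "(v, int s) \<otimes>\<^bsub>lamplighter\<^esub> (a, 0) \<otimes>\<^bsub>lamplighter\<^esub> inv\<^bsub>lamplighter\<^esub> (v, int s) \<in> V"
      using v that by (intro V.m_closed V.m_inv_closed) (simp_all add: V0)
    also have "(v, int s) \<otimes>\<^bsub>lamplighter\<^esub> (a, 0) \<otimes>\<^bsub>lamplighter\<^esub> inv\<^bsub>lamplighter\<^esub> (v, int s)
        = (X_pow (int s) *s a, 0)"
      by (simp add: inv) (simp add: lamplighter_def X minus_vec one)
    finally show ?thesis by (simp add: V0)
  qed
  have down: "X_pow (- int s) *s a \<in> V0" if "a \<in> V0" for a
  proof -
    have "inv\<^bsub>lamplighter\<^esub> (v, int s) \<otimes>\<^bsub>lamplighter\<^esub> (a, 0) \<otimes>\<^bsub>lamplighter\<^esub> (v, int s) \<in> V"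
      using v that by (intro V.m_closed V.m_inv_closed) (simp_all add: V0)
    also have "inv\<^bsub>lamplighter\<^esub> (v, int s) \<otimes>\<^bsub>lamplighter\<^esub> (a, 0) \<otimes>\<^bsub>lamplighter\<^esub> (v, int s)
        = (X_pow (- int s) *s a, 0)"
      by (simp add: inv) (simp add: lamplighter_def)
    finally show ?thesis by (simp add: V0)
  qed
  have pow: "X_pow (int s * i) *s a \<in> V0" if "a \<in> V0" for i a
  proof (induction i rule: int_induct[where k = 0])
    case base
    then show ?case using that by (simp add: one)
  next
    case (step1 i)
    then show ?case using up[of "X_pow (int s * i) *s a"] by (simp add: X algebra_simps)
  next
    case (step2 i)
    then show ?case using down[of "X_pow (int s * i) *s a"] by (simp add: X algebra_simps)
  qed
  have nat_mult: "of_nat k *s a \<in> V0" if "a \<in> V0" for k a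
    by (induction k) (use that in \<open>simp_all add: zero add vector_sadd_rdistrib\<close>)
  have single: "Poly_Mapping.single (int s * i) c *s a \<in> V0" if "a \<in> V0" for i c a
  proof -
    have "c = of_nat (nat (to_int_mod_ring c))"
      using range_to_int_mod_ring[where 'a = 'a] of_int_mod_ring_to_int_mod_ring[of c]
      by (auto simp: of_nat_of_int_mod_ring)
    then obtain k where k: "c = of_nat k" ..
    have "Poly_Mapping.single (int s * i) c *s a = of_nat k *s (X_pow (int s * i) *s a)"
      by (simp add: vec_eq_iff k X_pow_def mult_single single_of_nat [symmetric]
            mult.assoc [symmetric] del: single_of_nat)
    then show ?thesis using nat_mult pow that by simp
  qed
  have smult: "subst_X_pow s f *s a \<in> V0" if "a \<in> V0" for f a
    by (induction f rule: laurent_induct)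
      (use that in \<open>simp_all add: zero add single subst_X_pow_add vector_sadd_rdistrib\<close>)
  interpret module laurent_ring "lamp_module s :: ('a laurent, 'a laurent ^ 'b) module"
    by (rule module_lamp_module)
  have minus: "\<ominus>\<^bsub>lamp_module s\<^esub> a = - a" for a :: "'a laurent ^ 'b"
    by (rule M.minus_equality) (simp_all add: lamp_module_def)
  show ?thesis
    by (rule submoduleI) (use zero add neg smult minus in \<open>auto simp: lamp_module_def\<close>)
qed

end

theory Submission
  imports Defs "HOL-Algebra.Sylow"
begin

text \<open>Let \<open>s > 0\<close>.  A subgroup is of finite index iff it has a nonzero shift and its intersection
  with \<open>\<A>\<^sub>n\<close> is of finite index there.  So if \<open>V\<close> is weakly maximal, the \<open>R\<close>-module \<open>M = \<A>\<^sub>n\<^sup>s / V\<^sub>0\<close> is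
  infinite with all proper quotients finite.  Such an \<open>M\<close> is torsion-free, since \<open>R m\<close> is finite for a torsion element \<open>m\<close>;
  and for \<open>a \<noteq> 0\<close> in \<open>M\<close> some \<open>f \<noteq> 0\<close> kills the finite module \<open>M / R a\<close>, so multiplication by \<open>f\<close> embeds
  \<open>M\<close> into \<open>R a \<cong> R\<close> as a nonzero ideal, which is principal.

  Conversely, let \<open>M \<cong> R\<close>.  If \<open>V\<^sub>0\<close> is invariant under \<open>x\<^sup>t\<close> with \<open>s = t m\<close>, then \<open>x\<^sup>t\<close> acts on \<open>M\<close> as some
  \<open>u \<in> R\<close> with \<open>u\<^sup>m = x\<close>, and comparing degrees gives \<open>m = 1\<close>.  Hence a subgroup properly containing \<open>V\<close>
  meets \<open>\<A>\<^sub>n\<close> in more than \<open>V\<^sub>0\<close>, and the quotients of \<open>R\<close> by nonzero ideals are finite.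

  The same rigidity governs closedness.  Normal subgroups of \<open>p\<close>-power index contain \<open>(0, p\<^sup>e)\<close> for some \<open>e\<close>, so for closed \<open>V\<close> the
  group \<open>V\<^sub>0\<close> is invariant under \<open>x\<^sup>t\<close>, where \<open>t\<close> is the \<open>p\<close>-part of \<open>s\<close>.  For \<open>s\<close> a power of \<open>p\<close>, the
  subgroups \<open>(x\<^sup>q - 1) \<A>\<^sub>n \<rtimes> q \<int>\<close> with \<open>q\<close> a power of \<open>p\<close> separate \<open>V\<close> from its complement.\<close>

section \<open>Laurent polynomials over a prime field\<close>

lemma lookup_single_mult:
  fixes g :: "'p::prime_card laurent"
  shows "Poly_Mapping.lookup (Poly_Mapping.single i c * g) k = c * Poly_Mapping.lookup g (k - i)"
proof (induction g rule: laurent_induct)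
  case (2 f j d)
  have "i + j = k \<longleftrightarrow> j = k - i" by auto
  with 2 show ?case
    by (simp add: distrib_left lookup_add mult_single lookup_single when_def)
qed simp

lemma lookup_laurent_mult:
  fixes f g :: "'p::prime_card laurent"
  shows "Poly_Mapping.lookup (f * g) k =
    (\<Sum>i\<in>Poly_Mapping.keys f. Poly_Mapping.lookup f i * Poly_Mapping.lookup g (k - i))"
  by (subst sum_single_lookup[of f, symmetric])
    (simp only: sum_distrib_right lookup_sum lookup_single_mult)

text \<open>Among exponents \<open>i \<le> a\<close> and \<open>j \<le> b\<close>, only the pair
  \<open>(a, b)\<close> has sum \<open>a + b\<close>.\<close>

lemma lookup_mult_top:
  fixes f g :: "'p::prime_card laurent"
  assumes f: "Poly_Mapping.keys f \<subseteq> {..a}" and g: "Poly_Mapping.keys g \<subseteq> {..b}"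
  shows "Poly_Mapping.lookup (f * g) (a + b) = Poly_Mapping.lookup f a * Poly_Mapping.lookup g b"
proof -
  have "Poly_Mapping.lookup (f * g) (a + b) =
      (\<Sum>i\<in>Poly_Mapping.keys f. if i = a then Poly_Mapping.lookup f a * Poly_Mapping.lookup g b else 0)"
    unfolding lookup_laurent_mult
  proof (rule sum.cong)
    fix i assume i: "i \<in> Poly_Mapping.keys f"
    have "Poly_Mapping.lookup g (a + b - i) = 0" if "i \<noteq> a"
    proof (rule ccontr)
      assume "Poly_Mapping.lookup g (a + b - i) \<noteq> 0"
      then have "a + b - i \<in> {..b}" using g by (auto simp: in_keys_iff)
      with i f that show False by auto
    qed
    then show "Poly_Mapping.lookup f i * Poly_Mapping.lookup g (a + b - i) =
        (if i = a then Poly_Mapping.lookup f a * Poly_Mapping.lookup g b else 0)"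
      by auto
  qed simp
  then show ?thesis
    by (auto simp: in_keys_iff)
qed

lemma keys_mult_atMost:
  fixes f g :: "'p::prime_card laurent"
  assumes "Poly_Mapping.keys f \<subseteq> {..a}" "Poly_Mapping.keys g \<subseteq> {..b}"
  shows "Poly_Mapping.keys (f * g) \<subseteq> {..a + b}"
proof
  fix k assume "k \<in> Poly_Mapping.keys (f * g)"
  then obtain i j where "i \<in> Poly_Mapping.keys f" "j \<in> Poly_Mapping.keys g" "k = i + j"
    using keys_mult[of f g] by blast
  moreover have "i \<le> a" "j \<le> b" using calculation assms by auto
  ultimately show "k \<in> {..a + b}" by simp
qed

section \<open>Powers of x: roots of x and multiples of \<open>x^m - 1\<close>\<close>

lemma X_pow_add: "X_pow (i + j) = X_pow i * X_pow j"
  by (simp add: X_pow_def mult_single)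

lemma X_pow_0 [simp]: "X_pow 0 = 1"
  by (simp add: X_pow_def)

lemma X_pow_mult_minus [simp]: "X_pow i * X_pow (- i) = 1" "X_pow (- i) * X_pow i = 1"
  by (simp_all flip: X_pow_add)

text \<open>If \<open>d\<close> is the top exponent of \<open>u\<close>, then \<open>u ^ m\<close>
  has top exponent \<open>m * d\<close>, so \<open>m * d = 1\<close> in the integers. This rigidity
  serves both weak maximality and closedness.\<close>

lemma power_eq_X_pow_1:
  fixes u :: "'p::prime_card laurent"
  assumes "u ^ m = X_pow 1"
  shows "m = 1"
proof -
  have nz: "X_pow 1 \<noteq> (0 :: 'p laurent)"
    by (metis X_pow_mult_minus(1) mult_zero_left zero_neq_one)
  have u: "u \<noteq> 0"
  proof
    assume "u = 0"
    \<comment> \<open>Since \<open>0 ^ 0 = 1\<close>, a vanishing \<open>u\<close> leaves the case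
      \<open>m = 0\<close>; there 1 has coefficient 0 at exponent 1.\<close>
    with assms have "m = 0" using nz by (cases m) auto
    then have "1 = (X_pow 1 :: 'p laurent)" using assms by simp
    then have "Poly_Mapping.lookup (1 :: 'p laurent) 1 = Poly_Mapping.lookup (X_pow 1 :: 'p laurent) 1" by simp
    then show False by (simp add: X_pow_def lookup_one)
  qed
  define d where "d = Max (Poly_Mapping.keys u)"
  have d: "Poly_Mapping.keys u \<subseteq> {..d}" "Poly_Mapping.lookup u d \<noteq> 0"
    using u Max_in[of "Poly_Mapping.keys u"] by (auto simp: d_def in_keys_iff)
  have "Poly_Mapping.keys (u ^ k) \<subseteq> {..int k * d} \<and> Poly_Mapping.lookup (u ^ k) (int k * d) \<noteq> 0" for k
  proof (induction k)
    case (Suc k)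
    then show ?case
      using keys_mult_atMost[OF d(1), of "u ^ k" "int k * d"] lookup_mult_top[OF d(1), of "u ^ k" "int k * d"] d(2)
      by (simp add: algebra_simps)
  qed (simp add: lookup_one)
  from this[of m] have "int m * d = 1"
    by (auto simp: assms X_pow_def lookup_single when_def split: if_splits)
  then have "int m dvd 1" by (metis dvd_triv_left)
  then show ?thesis by simp
qed

text \<open>In \<open>x^m g - g\<close> the top term of \<open>x^m g\<close> and the bottom term of
  \<open>g\<close> cannot cancel.\<close>

lemma X_pow_minus_one_mult_keys:
  fixes g :: "'p::prime_card laurent"
  assumes "m > 0" "g \<noteq> 0"
  shows "\<exists>i j. i \<in> Poly_Mapping.keys ((X_pow m - 1) * g) \<and> j \<in> Poly_Mapping.keys ((X_pow m - 1) * g) \<and> i \<ge> j + m"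
proof (intro exI conjI)
  let ?K = "Poly_Mapping.keys g"
  have K: "finite ?K" "?K \<noteq> {}" using assms by auto
  have *: "Poly_Mapping.lookup ((X_pow m - 1) * g) k = Poly_Mapping.lookup g (k - m) - Poly_Mapping.lookup g k" for k
    by (simp add: left_diff_distrib lookup_minus X_pow_def lookup_single_mult)
  have "Max ?K \<in> ?K" "Min ?K \<in> ?K" using Max_in[OF K] Min_in[OF K] .
  moreover have "Max ?K + m \<notin> ?K" using Max_ge[OF K(1), of "Max ?K + m"] assms(1) by linarith
  moreover have "Min ?K - m \<notin> ?K" using Min_le[OF K(1), of "Min ?K - m"] assms(1) by linarith
  ultimately show "Max ?K + m \<in> Poly_Mapping.keys ((X_pow m - 1) * g)"
    "Min ?K \<in> Poly_Mapping.keys ((X_pow m - 1) * g)"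
    by (auto simp: in_keys_iff *)
  show "Max ?K + m \<ge> Min ?K + m"
    using Max_ge[OF K(1) Min_in[OF K]] by simp
qed

lemma X_pow_minus_one_neq_0:
  assumes "m > 0"
  shows "X_pow m - 1 \<noteq> (0 :: 'p::prime_card laurent)"
  using X_pow_minus_one_mult_keys[OF assms, of "1 :: 'p laurent"] by auto

text \<open>The witness \<open>M\<close> is the distance between the extreme exponents of
  \<open>f\<close>; a nonzero multiple of \<open>x^m - 1\<close> spreads over a distance of at least
  \<open>m\<close>.\<close>

lemma not_X_pow_minus_one_dvd:
  fixes f :: "'p::prime_card laurent"
  assumes "f \<noteq> 0"
  shows "\<exists>M. \<forall>m>M. \<not> (X_pow m - 1) dvd f"
proof (intro exI allI impI notI)
  let ?K = "Poly_Mapping.keys f"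
  fix m assume m: "m > Max ?K - Min ?K" and "(X_pow m - 1) dvd f"
  then obtain g where f: "f = (X_pow m - 1) * g" by auto
  have K: "finite ?K" "?K \<noteq> {}" using assms by auto
  have "Max ?K \<ge> Min ?K" using Max_ge[OF K(1) Min_in[OF K]] .
  with m have "m > 0" by simp
  moreover have "g \<noteq> 0" using f assms by auto
  ultimately obtain i j where "i \<in> ?K" "j \<in> ?K" "i \<ge> j + m"
    using X_pow_minus_one_mult_keys[of m g] unfolding f by blast
  then show False
    using m Max_ge[OF K(1), of i] Min_le[OF K(1), of j] by linarith
qed

text \<open>The upward step is \<open>x^(q(i+1)) - 1 = x^q (x^(qi) - 1) + (x^q - 1)\<close>; the
  downward step divides by the unit \<open>x^q\<close>, so negative \<open>k\<close> is
  covered.\<close>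

lemma X_pow_minus_one_dvd: "(X_pow q - 1) dvd (X_pow (q * k) - 1 :: 'p::prime_card laurent)"
proof (induction k rule: int_induct[where k = 0])
  case (step1 i)
  have "X_pow (q * (i + 1)) - 1 = X_pow q * (X_pow (q * i) - 1) + (X_pow q - 1 :: 'p laurent)"
    by (simp add: distrib_left X_pow_add algebra_simps)
  then show ?case using step1 by (metis dvd_add dvd_mult dvd_refl)
next
  case (step2 i)
  have "q * i = q + q * (i - 1)" by (simp add: algebra_simps)
  then have "X_pow (q * i) = X_pow q * (X_pow (q * (i - 1)) :: 'p laurent)"
    by (simp only: X_pow_add)
  then have "X_pow (q * (i - 1)) - 1 = X_pow (- q) * (X_pow (q * i) - 1) - X_pow (- q) * (X_pow q - 1 :: 'p laurent)"
    by (simp add: right_diff_distrib flip: mult.assoc)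
  then show ?case using step2 by (metis dvd_diff dvd_mult dvd_refl)
qed simp

section \<open>Division with remainder and ideals\<close>

lemma finite_keys_subset:
  assumes "finite A"
  shows "finite {r :: 'p::prime_card laurent. Poly_Mapping.keys r \<subseteq> A}"
proof (rule finite_imageD[where f = Poly_Mapping.lookup])
  have "finite {f :: int \<Rightarrow> 'p mod_ring. \<forall>x. (x \<in> A \<longrightarrow> f x \<in> UNIV) \<and> (x \<notin> A \<longrightarrow> f x = 0)}"
    by (rule finite_set_of_finite_funs) (use assms in auto)
  then show "finite (Poly_Mapping.lookup ` {r :: 'p::prime_card laurent. Poly_Mapping.keys r \<subseteq> A})"
    by (rule rev_finite_subset) (auto simp: in_keys_iff)
qed (simp add: inj_on_def poly_mapping.lookup_inject)

text \<open>Both extreme coefficients of \<open>h\<close> are units, so a polynomial sticking out of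
  the window \<open>{0..<w}\<close> by one exponent, on either side, can be pushed back modulo
  \<open>h\<close>. Hence the classes represented in the window are stable under x and its
  inverse.\<close>

lemma laurent_division:
  fixes h g :: "'p::prime_card laurent"
  assumes "h \<noteq> 0"
  defines "w \<equiv> Max (Poly_Mapping.keys h) - Min (Poly_Mapping.keys h)"
  shows "\<exists>q r. g = q * h + r \<and> Poly_Mapping.keys r \<subseteq> {0..<w}"
proof -
  let ?K = "Poly_Mapping.keys h"
  have K: "finite ?K" "?K \<noteq> {}" using assms by auto
  \<comment> \<open>\<open>h0\<close> differs from \<open>h\<close> by a unit and occupies the
    exponents 0 to \<open>w\<close>, with nonzero coefficients at both ends.\<close>
  define h0 where "h0 = X_pow (- Min ?K) * h"
  have look: "Poly_Mapping.lookup h0 k = Poly_Mapping.lookup h (k + Min ?K)" for k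
    by (simp add: h0_def X_pow_def lookup_single_mult)
  have keys0: "Poly_Mapping.keys h0 \<subseteq> {0..w}"
  proof
    fix k assume "k \<in> Poly_Mapping.keys h0"
    then have "k + Min ?K \<in> ?K" by (simp add: in_keys_iff look)
    then have "k + Min ?K \<le> Max ?K" "Min ?K \<le> k + Min ?K"
      using Max_ge[OF K(1)] Min_le[OF K(1)] by blast+
    then show "k \<in> {0..w}" unfolding w_def atLeastAtMost_iff by linarith
  qed
  have c0: "Poly_Mapping.lookup h0 0 \<noteq> 0" and cw: "Poly_Mapping.lookup h0 w \<noteq> 0"
    using Min_in[OF K] Max_in[OF K] by (auto simp: look w_def in_keys_iff)
  have w: "w \<ge> 0" using Max_ge[OF K(1) Min_in[OF K]] by (simp add: w_def)
  define P where "P g \<longleftrightarrow> (\<exists>q r. g = q * h + r \<and> Poly_Mapping.keys r \<subseteq> {0..<w})" for g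
  have P_small: "P r" if "Poly_Mapping.keys r \<subseteq> {0..<w}" for r
    unfolding P_def using that by (intro exI[of _ 0] exI[of _ r]) auto
  have P_add: "P (f + g)" if "P f" "P g" for f g
  proof -
    obtain q r q' r' where *: "f = q * h + r" "Poly_Mapping.keys r \<subseteq> {0..<w}"
      "g = q' * h + r'" "Poly_Mapping.keys r' \<subseteq> {0..<w}"
      using \<open>P f\<close> \<open>P g\<close> unfolding P_def by blast
    then have "Poly_Mapping.keys (r + r') \<subseteq> {0..<w}"
      using Poly_Mapping.keys_add[of r r'] by blast
    moreover have "f + g = (q + q') * h + (r + r')"
      using * by (simp add: algebra_simps)
    ultimately show ?thesis unfolding P_def by blast
  qed
  have P_mult: "P (f * h)" for f
    unfolding P_def by (intro exI[of _ f] exI[of _ 0]) simp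
  have P_diff: "P f" if "P (f - Poly_Mapping.single j c * h0)" for f j c
    using P_add[OF that P_mult[of "Poly_Mapping.single j c * X_pow (- Min ?K)"]]
    by (simp add: h0_def mult.assoc)
  have P_up: "P r" if r: "Poly_Mapping.keys r \<subseteq> {0..w}" for r
  proof -
    define c where "c = Poly_Mapping.lookup r w / Poly_Mapping.lookup h0 w"
    have "Poly_Mapping.keys (r - Poly_Mapping.single 0 c * h0) \<subseteq> {0..<w}"
    proof
      fix k assume k: "k \<in> Poly_Mapping.keys (r - Poly_Mapping.single 0 c * h0)"
      then have "Poly_Mapping.lookup r k \<noteq> 0 \<or> Poly_Mapping.lookup h0 k \<noteq> 0"
        by (auto simp: in_keys_iff lookup_minus lookup_single_mult)
      then have "k \<in> {0..w}" using r keys0 by (auto simp: in_keys_iff)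
      moreover have "k \<noteq> w"
        using k cw by (auto simp: in_keys_iff lookup_minus lookup_single_mult c_def)
      ultimately show "k \<in> {0..<w}" by simp
    qed
    then show ?thesis using P_small P_diff by blast
  qed
  have P_down: "P r" if r: "Poly_Mapping.keys r \<subseteq> {-1..<w}" for r
  proof -
    \<comment> \<open>The shift of \<open>h0\<close> by -1 occupies the exponents -1 to
      \<open>w - 1\<close>, so cancelling the term at -1 creates no overflow at the top.\<close>
    define c where "c = Poly_Mapping.lookup r (-1) / Poly_Mapping.lookup h0 0"
    have "Poly_Mapping.keys (r - Poly_Mapping.single (-1) c * h0) \<subseteq> {0..<w}"
    proof
      fix k assume k: "k \<in> Poly_Mapping.keys (r - Poly_Mapping.single (-1) c * h0)"
      then have "Poly_Mapping.lookup r k \<noteq> 0 \<or> Poly_Mapping.lookup h0 (k + 1) \<noteq> 0"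
        by (auto simp: in_keys_iff lookup_minus lookup_single_mult)
      then have "k \<in> {-1..<w}" using r keys0 by (auto simp: in_keys_iff)
      moreover have "k \<noteq> -1"
        using k c0 by (auto simp: in_keys_iff lookup_minus lookup_single_mult c_def)
      ultimately show "k \<in> {0..<w}" by auto
    qed
    then show ?thesis using P_small P_diff by blast
  qed
  have P_shift: "P (X_pow j * f)" if f: "P f" and j: "j = 1 \<or> j = -1" for f j
  proof -
    obtain q r where qr: "f = q * h + r" "Poly_Mapping.keys r \<subseteq> {0..<w}"
      using f unfolding P_def by blast
    have "Poly_Mapping.keys (X_pow j * r) \<subseteq> (\<lambda>k. k + j) ` Poly_Mapping.keys r"
      by (force simp: in_keys_iff X_pow_def lookup_single_mult intro: image_eqI[of _ _ "k - j" for k])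
    then have "Poly_Mapping.keys (X_pow j * r) \<subseteq> (\<lambda>k. k + j) ` {0..<w}" using qr(2) by blast
    then have "Poly_Mapping.keys (X_pow j * r) \<subseteq> {0..w} \<or> Poly_Mapping.keys (X_pow j * r) \<subseteq> {-1..<w}"
      using j by force
    then have "P (X_pow j * r)" using P_up P_down by blast
    then show ?thesis
      using P_add P_mult[of "X_pow j * q"] by (simp add: qr(1) distrib_left mult.assoc)
  qed
  have P_single: "P (Poly_Mapping.single i c)" for i c
  proof (induction i rule: int_induct[where k = 0])
    case base
    \<comment> \<open>For \<open>w = 0\<close> the window is empty and a constant is not a
      remainder, but it still lies in \<open>{0..w}\<close>.\<close>
    show ?case by (rule P_up) (use w in auto)
  next
    case (step1 i)
    from P_shift[OF this(2), of 1] show ?case by (simp add: X_pow_def mult_single add.commute)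
  next
    case (step2 i)
    from P_shift[OF this(2), of "-1"] show ?case by (simp add: X_pow_def mult_single)
  qed
  have "P g"
    by (induction g rule: laurent_induct) (auto intro: P_small P_add P_single)
  then show ?thesis unfolding P_def .
qed

text \<open>Euclid's argument with the distance between extreme exponents as norm: a nonzero
  remainder modulo \<open>h\<close> has smaller norm than \<open>h\<close>, so an element of least
  norm generates.\<close>

lemma laurent_ideal_principal:
  fixes I :: "'p::prime_card laurent set"
  assumes diff: "\<And>f g. f \<in> I \<Longrightarrow> g \<in> I \<Longrightarrow> f - g \<in> I"
    and mult: "\<And>q f. f \<in> I \<Longrightarrow> q * f \<in> I"
    and "f \<in> I" "f \<noteq> 0"
  obtains h where "h \<noteq> 0" "I = range (\<lambda>q. q * h)"
proof -
  define width :: "'p laurent \<Rightarrow> nat" where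
    "width f = nat (Max (Poly_Mapping.keys f) - Min (Poly_Mapping.keys f))" for f
  obtain h where h: "h \<in> I" "h \<noteq> 0" and least: "\<And>g. g \<in> I \<Longrightarrow> g \<noteq> 0 \<Longrightarrow> width h \<le> width g"
    using ex_has_least_nat[of "\<lambda>f. f \<in> I \<and> f \<noteq> 0" f width] assms(3,4) by blast
  have "g \<in> range (\<lambda>q. q * h)" if g: "g \<in> I" for g
  proof -
    obtain q r where qr: "g = q * h + r" 
      and r: "Poly_Mapping.keys r \<subseteq> {0..<Max (Poly_Mapping.keys h) - Min (Poly_Mapping.keys h)}"
      using laurent_division[OF h(2)] by blast
    have "r \<in> I" using diff[OF g mult[OF h(1), of q]] by (simp add: qr)
    have "r = 0"
    proof (rule ccontr)
      assume "r \<noteq> 0"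
      then have "Max (Poly_Mapping.keys r) \<in> Poly_Mapping.keys r" "Min (Poly_Mapping.keys r) \<in> Poly_Mapping.keys r"
        by (auto intro: Max_in Min_in)
      then have "Max (Poly_Mapping.keys r) < Max (Poly_Mapping.keys h) - Min (Poly_Mapping.keys h)"
        "Max (Poly_Mapping.keys r) \<ge> 0" "Min (Poly_Mapping.keys r) \<ge> 0"
        using r by auto
      then have "width r < width h" unfolding width_def by linarith
      then show False using least[OF \<open>r \<in> I\<close> \<open>r \<noteq> 0\<close>] by simp
    qed
    then show ?thesis using qr by auto
  qed
  then show ?thesis using that[of h] h mult by blast
qed

section \<open>Finite index and groups of prime power order\<close>

text \<open>Any other prime \<open>r\<close> dividing the order would give a nontrivial element
  whose order divides both \<open>r\<close> and a power of \<open>p\<close>.\<close>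

lemma card_prime_power:
  fixes G (structure)
  assumes "group G" and fin: "finite (carrier G)" and p: "prime p"
    and tors: "\<And>x. x \<in> carrier G \<Longrightarrow> \<exists>e. x [^] (p ^ e :: nat) = \<one>"
  shows "\<exists>k. card (carrier G) = p ^ k"
proof -
  interpret group G by fact
  let ?n = "card (carrier G)"
  have n0: "?n > 0" using fin one_closed by (auto simp: card_gt_0_iff)
  have "r = p" if r: "prime r" "r dvd ?n" for r
  proof (rule ccontr)
    assume "r \<noteq> p"
    \<comment> \<open>With exponent 1, Sylow's theorem serves as Cauchy's theorem.\<close>
    have "Coset.order G = r ^ 1 * (?n div r)" using r by (simp add: Coset.order_def)
    from sylow_thm[OF r(1) is_group this fin] obtain H where H: "subgroup H G" "card H = r" by auto
    have fH: "finite H" using subgroup.subset[OF H(1)] fin finite_subset by blast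
    have "H \<noteq> {\<one>}" using H(2) r(1) by auto
    then obtain x where x: "x \<in> H" "x \<noteq> \<one>" using subgroup.one_closed[OF H(1)] by blast
    then have xc: "x \<in> carrier G" using subgroup.subset[OF H(1)] by blast
    obtain e where e: "x [^] (p ^ e) = \<one>" using tors[OF xc] by blast
    have "group (G\<lparr>carrier := H\<rparr>)" using H(1) by (rule subgroup.subgroup_is_group) (rule is_group)
    from group.pow_order_eq_1[OF this, of x] x H(2) have "x [^] r = \<one>"
      by (simp add: Coset.order_def nat_pow_consistent[symmetric])
    then have "ord x dvd r" "ord x dvd p ^ e" using e xc by (simp_all add: pow_eq_id)
    moreover have "coprime r (p ^ e)" using \<open>r \<noteq> p\<close> r(1) p by (simp add: primes_coprime)
    ultimately have "ord x = 1" by (metis coprime_common_divisor_nat)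
    then show False using x xc ord_eq_1 by blast
  qed
  then have "prime_factors ?n \<subseteq> {p}" by (auto simp: prime_factors_dvd)
  then have "?n = p ^ multiplicity p ?n"
    using prime_factorization_nat[of ?n] n0
    by (cases "prime_factors ?n = {}") (auto simp: subset_singleton_iff)
  then show ?thesis by blast
qed

text \<open>Trades the set of cosets for a finite set of representatives, so that indices can be
  computed with explicit group elements.\<close>

lemma finite_index_iff:
  assumes "group G" "subgroup H G"
  shows "finite_index G H \<longleftrightarrow>
    (\<exists>F. finite F \<and> F \<subseteq> carrier G \<and> (\<forall>g\<in>carrier G. \<exists>f\<in>F. g \<otimes>\<^bsub>G\<^esub> inv\<^bsub>G\<^esub> f \<in> H))"
proof -
  interpret group G by fact
  interpret H: subgroup H G by fact
  have eq: "H #>\<^bsub>G\<^esub> g = H #>\<^bsub>G\<^esub> f \<longleftrightarrow> g \<otimes>\<^bsub>G\<^esub> inv\<^bsub>G\<^esub> f \<in> H" if "f \<in> carrier G" "g \<in> carrier G" for f g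
    using H.rcos_module[OF is_group that] that repr_independence[of g H f] repr_independenceD[of H g f] H.subgroup_axioms
    by metis
  show ?thesis
  proof
    assume "finite_index G H"
    then have "finite (rcosets\<^bsub>G\<^esub> H)" by (simp add: finite_index_def)
    moreover have "rcosets\<^bsub>G\<^esub> H = (\<lambda>g. H #>\<^bsub>G\<^esub> g) ` carrier G" by (auto simp: RCOSETS_def)
    ultimately obtain F where F: "finite F" "F \<subseteq> carrier G" "rcosets\<^bsub>G\<^esub> H = (\<lambda>g. H #>\<^bsub>G\<^esub> g) ` F"
      by (metis finite_subset_image order_refl)
    have "\<exists>f\<in>F. g \<otimes>\<^bsub>G\<^esub> inv\<^bsub>G\<^esub> f \<in> H" if g: "g \<in> carrier G" for g
    proof -
      have "H #>\<^bsub>G\<^esub> g \<in> (\<lambda>g. H #>\<^bsub>G\<^esub> g) ` F"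
        using g F(3) by (auto simp: RCOSETS_def)
      then obtain f where "f \<in> F" "H #>\<^bsub>G\<^esub> g = H #>\<^bsub>G\<^esub> f" by blast
      then show ?thesis using eq[of f g] g F(2) by blast
    qed
    with F(1,2) show "\<exists>F. finite F \<and> F \<subseteq> carrier G \<and> (\<forall>g\<in>carrier G. \<exists>f\<in>F. g \<otimes>\<^bsub>G\<^esub> inv\<^bsub>G\<^esub> f \<in> H)"
      by (intro exI[of _ F]) simp
  next
    assume "\<exists>F. finite F \<and> F \<subseteq> carrier G \<and> (\<forall>g\<in>carrier G. \<exists>f\<in>F. g \<otimes>\<^bsub>G\<^esub> inv\<^bsub>G\<^esub> f \<in> H)"
    then obtain F where F: "finite F" "F \<subseteq> carrier G" "\<And>g. g \<in> carrier G \<Longrightarrow> \<exists>f\<in>F. g \<otimes>\<^bsub>G\<^esub> inv\<^bsub>G\<^esub> f \<in> H"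
      by blast
    have "rcosets\<^bsub>G\<^esub> H \<subseteq> (\<lambda>g. H #>\<^bsub>G\<^esub> g) ` F"
    proof
      fix C assume "C \<in> rcosets\<^bsub>G\<^esub> H"
      then obtain g where g: "g \<in> carrier G" "C = H #>\<^bsub>G\<^esub> g" by (auto simp: RCOSETS_def)
      then obtain f where "f \<in> F" "g \<otimes>\<^bsub>G\<^esub> inv\<^bsub>G\<^esub> f \<in> H" using F(3) by blast
      then show "C \<in> (\<lambda>g. H #>\<^bsub>G\<^esub> g) ` F" using eq[of f g] g F(2) by blast
    qed
    then show "finite_index G H" using F(1) finite_surj by (auto simp: finite_index_def)
  qed
qed

section \<open>Subgroups of the lamplighter group\<close>

text \<open>Finite index for an additive subgroup \<open>W\<close>, phrased by representatives; it
  is applied both to subgroups of \<open>R^n\<close> and to ideals of R.\<close>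

definition finite_quotient :: "'a::ab_group_add set \<Rightarrow> bool" where
  "finite_quotient W \<longleftrightarrow> (\<exists>F. finite F \<and> (\<forall>a. \<exists>b\<in>F. a - b \<in> W))"

lemma finite_quotient_UNIV: "finite_quotient UNIV"
  unfolding finite_quotient_def by (intro exI[of _ "{0}"]) auto

lemma X_pow_vec_assoc: "X_pow i *s (X_pow j *s a) = X_pow (i + j) *s a"
  by (simp add: vector_smult_assoc X_pow_add)

declare vector_smult_rneg [simp]

lemma carrier_lamplighter [simp]: "carrier lamplighter = UNIV"
  by (simp add: lamplighter_def)

lemma mult_lamplighter [simp]:
  "(v, s) \<otimes>\<^bsub>lamplighter\<^esub> (w, t) = (v + X_pow s *s w, s + t)"
  by (simp add: lamplighter_def)

lemma one_lamplighter [simp]: "\<one>\<^bsub>lamplighter\<^esub> = (0, 0)"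
  by (simp add: lamplighter_def)

lemma inv_lamplighter [simp]:
  "inv\<^bsub>lamplighter\<^esub> (v, s) = (- (X_pow (- s) *s v), - s)"
  by (rule group.inv_equality[OF group_lamplighter]) simp_all

definition base :: "((('p::prime_card laurent) ^ 'n) \<times> int) set \<Rightarrow> ('p laurent ^ 'n) set" where
  "base V = {a. (a, 0) \<in> V}"

locale lamplighter_subgroup =
  fixes V :: "((('p::prime_card laurent) ^ 'n) \<times> int) set"
  assumes subgroup: "subgroup V lamplighter"
begin

section \<open>Closure properties of a subgroup and of its base\<close>

lemma mem_mult: "(v, s) \<in> V \<Longrightarrow> (w, t) \<in> V \<Longrightarrow> (v + X_pow s *s w, s + t) \<in> V"
  using subgroup.m_closed[OF subgroup] by force

lemma mem_inv: "(v, s) \<in> V \<Longrightarrow> (- (X_pow (- s) *s v), - s) \<in> V"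
  using subgroup.m_inv_closed[OF subgroup] by force

lemma mem_zero: "(0, 0) \<in> V"
  using subgroup.one_closed[OF subgroup] by simp

lemma base_zero: "0 \<in> base V"
  using mem_zero by (simp add: base_def)

lemma base_add: "a \<in> base V \<Longrightarrow> b \<in> base V \<Longrightarrow> a + b \<in> base V"
  using mem_mult[of a 0 b 0] by (simp add: base_def)

lemma base_uminus: "a \<in> base V \<Longrightarrow> - a \<in> base V"
  using mem_inv[of a 0] by (simp add: base_def)

lemma base_diff: "a \<in> base V \<Longrightarrow> b \<in> base V \<Longrightarrow> a - b \<in> base V"
  using base_add[OF _ base_uminus, of a b] by simp

text \<open>Conjugation by \<open>(w, k)\<close> acts on the base as multiplication by
  \<open>x^k\<close>, whatever \<open>w\<close> is.\<close>

lemma base_shift: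
  assumes "(w, k) \<in> V" "a \<in> base V"
  shows "X_pow k *s a \<in> base V"
proof -
  have "(w + X_pow k *s a, k) \<in> V" using mem_mult[of w k a 0] assms by (simp add: base_def)
  from mem_mult[OF this mem_inv[OF assms(1)]] show ?thesis
    by (simp add: base_def X_pow_vec_assoc)
qed

lemma mem_add_base: "c \<in> base V \<Longrightarrow> (w, k) \<in> V \<Longrightarrow> (c + w, k) \<in> V"
  using mem_mult[of c 0 w k] by (simp add: base_def)

lemma diff_mem_base: "(w, k) \<in> V \<Longrightarrow> (w', k) \<in> V \<Longrightarrow> w - w' \<in> base V"
  using mem_mult[OF _ mem_inv[of w' k], of w k] by (simp add: base_def X_pow_vec_assoc)

lemma mem_multiple:
  assumes "(w, k) \<in> V"
  shows "\<exists>u. (u, k * i) \<in> V"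
proof (induction i rule: int_induct[where k = 0])
  case base
  then show ?case using mem_zero by auto
next
  case (step1 i)
  then obtain u where "(u, k * i) \<in> V" by blast
  from mem_mult[OF this assms] show ?case by (auto simp: distrib_left)
next
  case (step2 i)
  then obtain u where "(u, k * i) \<in> V" by blast
  from mem_mult[OF this mem_inv[OF assms]] show ?case by (auto simp: right_diff_distrib)
qed

lemma mem_zero_multiple:
  assumes "(0, k) \<in> V"
  shows "(0, k * i) \<in> V"
proof (induction i rule: int_induct[where k = 0])
  case base
  then show ?case using mem_zero by simp
next
  case (step1 i)
  from mem_mult[OF step1(2) assms] show ?case by (simp add: distrib_left)
next
  case (step2 i)
  from mem_mult[OF step2(2) mem_inv[OF assms]] show ?case by (simp add: right_diff_distrib)
qed

lemma mem_gcd: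
  assumes "(w, k) \<in> V" "(w', l) \<in> V"
  shows "\<exists>u. (u, gcd k l) \<in> V"
proof -
  obtain i j where "i * k + j * l = gcd k l" using bezout_int by blast
  moreover obtain u u' where "(u, k * i) \<in> V" "(u', l * j) \<in> V"
    using mem_multiple[OF assms(1)] mem_multiple[OF assms(2)] by blast
  ultimately show ?thesis
    using mem_mult[of u "k * i" u' "l * j"] by (auto simp: mult.commute)
qed

text \<open>The two products of the given elements, in either order, have the same shift, so their
  first components differ by an element of the base.\<close>

lemma commutator_mem_base:
  assumes "(w, k) \<in> V" "(w', l) \<in> V"
  shows "(X_pow l - 1) *s w - (X_pow k - 1) *s w' \<in> base V"
  using diff_mem_base[OF mem_mult[OF assms(2,1)], of "w + X_pow k *s w'"] mem_mult[OF assms]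
  by (simp add: add.commute vector_sub_rdistrib algebra_simps)

section \<open>The index of a subgroup, read off from its base and its shifts\<close>

lemma finite_index_imp_finite_quotient:
  assumes "finite_index lamplighter V"
  shows "finite_quotient (base V)"
proof -
  obtain F where F: "finite F" "\<And>g. \<exists>f\<in>F. g \<otimes>\<^bsub>lamplighter\<^esub> inv\<^bsub>lamplighter\<^esub> f \<in> V"
    using assms finite_index_iff[OF group_lamplighter subgroup] by auto
  \<comment> \<open>A representative \<open>f\<close> may have nonzero shift; \<open>c f\<close> is
    an element of \<A>\<open>\<^sub>n\<close> in the same coset, and is arbitrary if the coset
    contains none.\<close>
  define c where "c f = (SOME a. (a, 0) \<otimes>\<^bsub>lamplighter\<^esub> inv\<^bsub>lamplighter\<^esub> f \<in> V)" for f
  have "\<exists>b\<in>c ` F. a - b \<in> base V" for a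
  proof -
    obtain f where f: "f \<in> F" "(a, 0) \<otimes>\<^bsub>lamplighter\<^esub> inv\<^bsub>lamplighter\<^esub> f \<in> V" using F(2) by blast
    from f(2) have "(c f, 0) \<otimes>\<^bsub>lamplighter\<^esub> inv\<^bsub>lamplighter\<^esub> f \<in> V" 
      unfolding c_def by (rule someI[where P = "\<lambda>a. (a, 0) \<otimes>\<^bsub>lamplighter\<^esub> inv\<^bsub>lamplighter\<^esub> f \<in> V"])
    with f have "a - c f \<in> base V"
      by (cases f) (use diff_mem_base in force)
    with f(1) show ?thesis by blast
  qed
  then show ?thesis
    unfolding finite_quotient_def using F(1) by (intro exI[of _ "c ` F"]) simp
qed

text \<open>If all shifts in \<open>V\<close> are zero, \<open>(0, k)\<close> can only be
  represented by an element of shift \<open>k\<close>, and infinitely many representatives are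
  needed.\<close>

lemma finite_index_imp_shift:
  assumes "finite_index lamplighter V"
  shows "\<exists>w k. k \<noteq> 0 \<and> (w, k) \<in> V"
proof (rule ccontr)
  assume none: "\<not> ?thesis"
  obtain F where F: "finite F" "\<And>g. \<exists>f\<in>F. g \<otimes>\<^bsub>lamplighter\<^esub> inv\<^bsub>lamplighter\<^esub> f \<in> V"
    using assms finite_index_iff[OF group_lamplighter subgroup] by auto
  have "k \<in> snd ` F" for k
  proof -
    obtain f where f: "f \<in> F" "(0, k) \<otimes>\<^bsub>lamplighter\<^esub> inv\<^bsub>lamplighter\<^esub> f \<in> V" using F(2) by blast
    obtain b l where fe: "f = (b, l)" by (cases f)
    have "(- (X_pow k *s (X_pow (- l) *s b)), k - l) \<in> V" using f(2) by (simp add: fe)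
    with none have "k - l = 0" by blast
    then have "k = snd f" by (simp add: fe)
    with f(1) show ?thesis by blast
  qed
  then have "UNIV \<subseteq> snd ` F" by blast
  then show False using F(1) infinite_UNIV_int finite_subset by blast
qed

lemma finite_indexI:
  assumes k: "(w, k) \<in> V" "k \<noteq> 0" and fin: "finite_quotient (base V)"
  shows "finite_index lamplighter V"
proof -
  obtain F where F: "finite F" "\<And>a. \<exists>b\<in>F. a - b \<in> base V"
    using fin unfolding finite_quotient_def by blast
  \<comment> \<open>Representatives combine \<open>F\<close> with the remainders modulo
    \<open>k\<close>. The interval is symmetric because \<open>i mod k\<close> takes the sign of
    \<open>k\<close>.\<close>
  have "\<exists>f\<in>F \<times> {-\<bar>k\<bar>..\<bar>k\<bar>}. g \<otimes>\<^bsub>lamplighter\<^esub> inv\<^bsub>lamplighter\<^esub> f \<in> V" for g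
  proof -
    obtain a i where g: "g = (a, i)" by (cases g)
    define d where "d = k * (i div k)"
    have d: "i = d + i mod k" by (simp add: d_def)
    obtain u where u: "(u, d) \<in> V" using mem_multiple[OF k(1)] by (auto simp: d_def)
    \<comment> \<open>The product of \<open>g\<close> with the inverse of
      \<open>(b, i mod k)\<close> has first component \<open>a - x^d b\<close>, so \<open>b\<close>
      has to approximate \<open>a - u\<close> shifted back by \<open>d\<close>.\<close>
    obtain b where b: "b \<in> F" "X_pow (- d) *s (a - u) - b \<in> base V" using F(2) by blast
    have "a - u - X_pow d *s b \<in> base V"
      using base_shift[OF u b(2)] by (simp add: vector_ssub_ldistrib X_pow_vec_assoc)
    from mem_add_base[OF this u] have "(a - X_pow d *s b, d) \<in> V" by simp
    then have "g \<otimes>\<^bsub>lamplighter\<^esub> inv\<^bsub>lamplighter\<^esub> (b, i mod k) \<in> V"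
      using d by (simp add: g X_pow_vec_assoc minus_mod_eq_mult_div d_def)
    moreover have "i mod k \<in> {-\<bar>k\<bar>..\<bar>k\<bar>}"
      using abs_mod_less[OF k(2), of i] by auto
    ultimately show ?thesis using b(1) by blast
  qed
  then show ?thesis
    unfolding finite_index_iff[OF group_lamplighter subgroup]
    by (intro exI[of _ "F \<times> {-\<bar>k\<bar>..\<bar>k\<bar>}"] conjI ballI)
      (use F(1) in \<open>simp_all only: carrier_lamplighter subset_UNIV finite_SigmaI finite_atLeastAtMost_int\<close>)
qed

end

text \<open>A coordinate exhibits the quotient by \<open>W\<close>, with \<open>x\<close> acting as \<open>x\<^sup>s\<close>, as free of rank one.\<close>

definition coordinate :: "nat \<Rightarrow> ('p::prime_card laurent ^ 'n) set \<Rightarrow> ('p laurent ^ 'n \<Rightarrow> 'p laurent) \<Rightarrow> bool" where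
  "coordinate s W \<phi> \<longleftrightarrow>
     (\<forall>a b. \<phi> (a + b) = \<phi> a + \<phi> b) \<and> (\<forall>f a. \<phi> (subst_X_pow s f *s a) = f * \<phi> a) \<and>
     (\<forall>a. \<phi> a = 0 \<longleftrightarrow> a \<in> W) \<and> surj \<phi>"

lemma r_coset_lamp_module:
  "W +>\<^bsub>lamp_module s\<^esub> a = (\<lambda>w. w + a) ` W"
  by (auto simp: a_r_coset_def' lamp_module_def)

text \<open>A coordinate is an isomorphism composed with the quotient map; it lets the later
  arguments work with vectors instead of cosets.\<close>

lemma module_isomorphic_iff_coordinate:
  fixes W :: "('p::prime_card laurent ^ 'n) set"
  assumes W: "submodule W laurent_ring (lamp_module s)"
  shows "module_isomorphic laurent_ring (factor_module (lamp_module s) W) laurent_module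
    \<longleftrightarrow> (\<exists>\<phi>. coordinate s W \<phi>)"
proof -
  let ?M = "lamp_module s :: ('p laurent, 'p laurent ^ 'n) module"
  interpret M: module laurent_ring ?M by (rule module_lamp_module)
  interpret W: submodule W laurent_ring ?M by fact
  interpret A: abelian_subgroup W ?M
    using W.subgroup_axioms M.abelian_group_axioms
    by (intro abelian_subgroupI3) (simp_all add: additive_subgroup_def)
  have W0: "0 \<in> W" using A.zero_closed by (simp add: lamp_module_def)
  have coset_eq: "W +>\<^bsub>?M\<^esub> a = W +>\<^bsub>?M\<^esub> b \<longleftrightarrow> a - b \<in> W" for a b
  proof
    assume "W +>\<^bsub>?M\<^esub> a = W +>\<^bsub>?M\<^esub> b"
    moreover have "a \<in> W +>\<^bsub>?M\<^esub> a" using W0 by (auto simp: r_coset_lamp_module)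
    ultimately have "a \<in> (\<lambda>w. w + b) ` W" by (simp only: r_coset_lamp_module)
    then show "a - b \<in> W" by auto
  next
    assume "a - b \<in> W"
    then have "a \<in> W +>\<^bsub>?M\<^esub> b" by (auto simp: r_coset_lamp_module intro!: image_eqI[of _ _ "a - b"])
    then show "W +>\<^bsub>?M\<^esub> a = W +>\<^bsub>?M\<^esub> b"
      using A.a_repr_independence'[of a b] by (simp add: lamp_module_def)
  qed
  have car: "carrier (factor_module ?M W) = range (\<lambda>a. W +>\<^bsub>?M\<^esub> a)"
    by (auto simp: factor_module_def A_RCOSETS_def' lamp_module_def)
  have add: "(W +>\<^bsub>?M\<^esub> a) \<oplus>\<^bsub>factor_module ?M W\<^esub> (W +>\<^bsub>?M\<^esub> b) = W +>\<^bsub>?M\<^esub> (a + b)" for a b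
    using A.a_rcos_sum[of a b] by (simp add: factor_module_def lamp_module_def)
  have smult: "f \<odot>\<^bsub>factor_module ?M W\<^esub> (W +>\<^bsub>?M\<^esub> a) = W +>\<^bsub>?M\<^esub> (subst_X_pow s f *s a)" for f a
    using smult_factor_module[OF module_lamp_module W, of f a]
    by (simp add: laurent_ring_def lamp_module_def)
  show ?thesis
  proof
    assume "module_isomorphic laurent_ring (factor_module ?M W) laurent_module"
    then obtain h where h: "bij_betw h (range (\<lambda>a. W +>\<^bsub>?M\<^esub> a)) UNIV"
      "\<And>a b. h ((W +>\<^bsub>?M\<^esub> a) \<oplus>\<^bsub>factor_module ?M W\<^esub> (W +>\<^bsub>?M\<^esub> b)) = h (W +>\<^bsub>?M\<^esub> a) + h (W +>\<^bsub>?M\<^esub> b)"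
      "\<And>f a. h (f \<odot>\<^bsub>factor_module ?M W\<^esub> (W +>\<^bsub>?M\<^esub> a)) = f * h (W +>\<^bsub>?M\<^esub> a)"
      by (auto simp: module_isomorphic_def module_iso_def car laurent_ring_def laurent_module_def)
    define \<phi> where "\<phi> a = h (W +>\<^bsub>?M\<^esub> a)" for a
    have addphi: "\<phi> (a + b) = \<phi> a + \<phi> b" for a b using h(2) by (simp add: \<phi>_def add)
    have "\<phi> 0 = 0" using addphi[of 0 0] by (metis add_0 add_cancel_left_left)
    moreover have "\<phi> a = \<phi> 0 \<longleftrightarrow> a - 0 \<in> W" for a
      unfolding \<phi>_def coset_eq[symmetric] by (rule inj_on_eq_iff[OF bij_betw_imp_inj_on[OF h(1)]]) auto
    ultimately have "\<phi> a = 0 \<longleftrightarrow> a \<in> W" for a by simp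
    moreover have "surj \<phi>"
      using bij_betw_imp_surj_on[OF h(1)] by (simp add: \<phi>_def image_image)
    moreover have "\<phi> (subst_X_pow s f *s a) = f * \<phi> a" for f a using h(3) by (simp add: \<phi>_def smult)
    ultimately show "\<exists>\<phi>. coordinate s W \<phi>"
      unfolding coordinate_def using addphi by (intro exI[of _ \<phi>]) simp
  next
    assume "\<exists>\<phi>. coordinate s W \<phi>"
    then obtain \<phi> where \<phi>: "\<And>a b. \<phi> (a + b) = \<phi> a + \<phi> b" "\<And>f a. \<phi> (subst_X_pow s f *s a) = f * \<phi> a"
      "\<And>a. \<phi> a = 0 \<longleftrightarrow> a \<in> W" "surj \<phi>"
      unfolding coordinate_def by blast
    have sub: "\<phi> a = \<phi> b \<longleftrightarrow> a - b \<in> W" for a b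
      using \<phi>(1)[of "a - b" b] by (simp flip: \<phi>(3))
    \<comment> \<open>The choice of representative is harmless: by \<open>sub\<close>, \<phi> is
      constant on each coset.\<close>
    define h where "h C = \<phi> (SOME a. C = W +>\<^bsub>?M\<^esub> a)" for C
    have h: "h (W +>\<^bsub>?M\<^esub> a) = \<phi> a" for a
      unfolding h_def by (rule someI2[of _ a]) (auto simp: coset_eq simp flip: sub)
    have "bij_betw h (carrier (factor_module ?M W)) UNIV"
      unfolding bij_betw_def car using \<phi>(4) by (auto simp: inj_on_def h sub coset_eq image_image)
    then have "h \<in> module_iso laurent_ring (factor_module ?M W) laurent_module"
      unfolding module_iso_def
      by (auto simp: car add smult h \<phi>(1,2) laurent_ring_def laurent_module_def)
    then show "module_isomorphic laurent_ring (factor_module ?M W) laurent_module"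
      by (auto simp: module_isomorphic_def)
  qed
qed

section \<open>Weakly maximal subgroups\<close>

lemma infinite_laurent: "infinite (UNIV :: 'p::prime_card laurent set)"
proof -
  have "inj (X_pow :: int \<Rightarrow> 'p laurent)"
    unfolding X_pow_def inj_def
    by (metis lookup_single_eq lookup_single_not_eq zero_neq_one)
  then show ?thesis
    using infinite_UNIV_int finite_imageD[of X_pow UNIV] finite_subset[OF subset_UNIV] by blast
qed

text \<open>Remainders modulo \<open>f\<close> live on a fixed finite set of exponents, with
  coefficients in a finite field.\<close>

lemma finite_quotient_dvd:
  fixes f :: "'p::prime_card laurent"
  assumes "f \<noteq> 0"
  shows "finite_quotient {g. f dvd g}"
proof -
  let ?w = "Max (Poly_Mapping.keys f) - Min (Poly_Mapping.keys f)"
  let ?F = "{r :: 'p laurent. Poly_Mapping.keys r \<subseteq> {0..<?w}}"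
  have "\<exists>r\<in>?F. g - r \<in> {g. f dvd g}" for g
    using laurent_division[OF assms, of g] by force
  then show ?thesis
    unfolding finite_quotient_def by (intro exI[of _ ?F]) (simp add: finite_keys_subset)
qed

lemma finite_quotient_smult:
  fixes h :: "'p::prime_card laurent"
  assumes "h \<noteq> 0"
  shows "finite_quotient {a :: 'p laurent ^ 'n. \<exists>b. a = h *s b}"
proof -
  obtain F where F: "finite F" "\<And>g. \<exists>r\<in>F. h dvd g - r"
    using finite_quotient_dvd[OF assms] unfolding finite_quotient_def by auto
  let ?F = "vec_lambda ` (UNIV \<rightarrow>\<^sub>E F) :: ('p laurent ^ 'n) set"
  have "\<exists>b\<in>?F. \<exists>c. a - b = h *s c" for a
  proof -
    have "\<forall>i. \<exists>r q. r \<in> F \<and> a $ i - r = h * q" using F(2) by (metis dvd_def)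
    then obtain r q where rq: "\<And>i. r i \<in> F" "\<And>i. a $ i - r i = h * q i" by metis
    have "vec_lambda r \<in> ?F" using rq(1) by (auto simp: PiE_def extensional_def)
    moreover have "a - vec_lambda r = h *s vec_lambda q" using rq(2) by (simp add: vec_eq_iff)
    ultimately show ?thesis by blast
  qed
  moreover have "finite ?F" using F(1) by (intro finite_imageI finite_PiE) auto
  ultimately show ?thesis
    unfolding finite_quotient_def by (intro exI[of _ ?F]) simp
qed

lemma subst_X_pow_diff: "subst_X_pow s (f - g) = subst_X_pow s f - subst_X_pow s g"
  using subst_X_pow_add[of s "f - g" g] by (simp add: algebra_simps)

lemma subst_X_pow_X_pow [simp]: "subst_X_pow s (X_pow i) = X_pow (int s * i)"
  by (simp add: X_pow_def)

lemma subst_X_pow_1 [simp]: "subst_X_pow s 1 = 1"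
  using subst_X_pow_X_pow[of s 0] by simp

lemma coordinateD:
  assumes "coordinate s W \<phi>"
  shows "\<phi> (a + b) = \<phi> a + \<phi> b" "\<phi> (a - b) = \<phi> a - \<phi> b"
    "\<phi> (subst_X_pow s f *s a) = f * \<phi> a" "\<phi> a = 0 \<longleftrightarrow> a \<in> W"
proof -
  have add: "\<phi> (a + b) = \<phi> a + \<phi> b" for a b using assms by (simp add: coordinate_def)
  then show "\<phi> (a + b) = \<phi> a + \<phi> b" .
  show "\<phi> (a - b) = \<phi> a - \<phi> b" using add[of "a - b" b] by (simp add: algebra_simps)
  show "\<phi> (subst_X_pow s f *s a) = f * \<phi> a" "\<phi> a = 0 \<longleftrightarrow> a \<in> W"
    using assms by (auto simp: coordinate_def)
qed

lemma coordinate_preimage: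
  assumes "coordinate s W \<phi>"
  obtains a where "\<phi> a = f"
  using assms unfolding coordinate_def surj_def by metis

lemma coordinate_not_finite_quotient:
  assumes "coordinate s W \<phi>"
  shows "\<not> finite_quotient W"
proof
  assume "finite_quotient W"
  then obtain F where F: "finite F" "\<And>a. \<exists>b\<in>F. a - b \<in> W"
    unfolding finite_quotient_def by blast
  have "f \<in> \<phi> ` F" for f
  proof -
    obtain a where "\<phi> a = f" using coordinate_preimage[OF assms] .
    moreover obtain b where "b \<in> F" "a - b \<in> W" using F(2) by blast
    moreover from this have "\<phi> a - \<phi> b = 0" by (simp flip: coordinateD(2)[OF assms] add: coordinateD(4)[OF assms])
    ultimately show ?thesis by auto
  qed
  then have "UNIV \<subseteq> \<phi> ` F" by blast
  then show False using F(1) infinite_laurent finite_surj by blast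
qed

text \<open>Multiplication by \<open>x^t\<close> commutes with the module action and preserves
  \<open>W\<close>, so it induces an endomorphism of a free module of rank one, that is,
  multiplication by some \<open>u\<close>; its m-th power is the action of x.\<close>

lemma coordinate_shift_invariant:
  assumes \<phi>: "coordinate s W \<phi>" and s: "s = t * m"
    and inv: "\<And>a. a \<in> W \<Longrightarrow> X_pow (int t) *s a \<in> W"
  shows "m = 1"
proof -
  obtain e where e: "\<phi> e = 1" using coordinate_preimage[OF \<phi>] .
  define u where "u = \<phi> (X_pow (int t) *s e)"
  have shift: "\<phi> (X_pow (int t) *s a) = \<phi> a * u" for a
  proof -
    \<comment> \<open>Modulo \<open>W\<close> every \<open>a\<close> is the multiple of the
      generator \<open>e\<close> by \<open>\<phi> a\<close>, so \<open>u\<close> is determined by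
      the image of \<open>e\<close>.\<close>
    have "\<phi> (a - subst_X_pow s (\<phi> a) *s e) = 0"
      by (simp add: coordinateD(2,3)[OF \<phi>] e)
    then have "a - subst_X_pow s (\<phi> a) *s e \<in> W" by (simp add: coordinateD(4)[OF \<phi>])
    from inv[OF this] have "\<phi> (X_pow (int t) *s a - subst_X_pow s (\<phi> a) *s (X_pow (int t) *s e)) = 0"
      unfolding coordinateD(4)[OF \<phi>]
      by (simp add: vector_ssub_ldistrib vector_smult_assoc mult.commute)
    then show ?thesis by (simp add: coordinateD(2,3)[OF \<phi>] u_def)
  qed
  have "\<phi> (X_pow (int t * int i) *s e) = u ^ i" for i
  proof (induction i)
    case (Suc i)
    have "X_pow (int t * int (Suc i)) *s e = X_pow (int t) *s (X_pow (int t * int i) *s e)"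
      by (simp add: X_pow_vec_assoc distrib_left)
    then show ?case using Suc shift by (simp add: mult.commute)
  qed (simp add: e)
  from this[of m] have "u ^ m = \<phi> (X_pow (int s) *s e)" by (simp add: s)
  also have "\<dots> = X_pow 1" using coordinateD(3)[OF \<phi>, of "X_pow 1" e] by (simp add: e)
  finally show ?thesis by (rule power_eq_X_pow_1)
qed

section \<open>Weak maximality in terms of the quotient module\<close>

context lamplighter_subgroup
begin

text \<open>Elements of \<open>V\<close> with shift \<open>s * i\<close> provide the monomials, and
  a coefficient in the prime field acts as a repeated sum.\<close>

lemma base_subst:
  assumes "(w, int s) \<in> V" "a \<in> base V"
  shows "subst_X_pow s f *s a \<in> base V"
proof (induction f rule: laurent_induct)
  case (2 f i c)
  obtain u where u: "(u, int s * i) \<in> V" using mem_multiple[OF assms(1)] by blast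
  have "c = of_nat (nat (to_int_mod_ring c))"
    using range_to_int_mod_ring[where 'a = 'p] of_int_mod_ring_to_int_mod_ring[of c]
    by (auto simp: of_nat_of_int_mod_ring)
  then obtain k where k: "c = of_nat k" ..
  have "Poly_Mapping.single (int s * i) (of_nat l) *s a \<in> base V" for l
  proof (induction l)
    case (Suc l)
    then show ?case
      using base_shift[OF u assms(2)] base_add
      by (simp add: single_add vector_sadd_rdistrib X_pow_def)
  qed (simp add: base_zero)
  with 2 show ?case by (simp add: k subst_X_pow_add vector_sadd_rdistrib base_add)
qed (simp add: base_zero)

text \<open>\<open>V\<close> normalizes \<open>W\<close>, so the product of \<open>W\<close> and
  \<open>V\<close> is a subgroup properly containing \<open>V\<close>; its base is exactly
  \<open>W\<close>.\<close>

lemma weakly_maximal_extension: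
  assumes wm: "weakly_maximal lamplighter V" and sub: "base V \<subset> W"
    and diff: "\<And>a b. a \<in> W \<Longrightarrow> b \<in> W \<Longrightarrow> a - b \<in> W"
    and shift: "\<And>w k a. (w, k) \<in> V \<Longrightarrow> a \<in> W \<Longrightarrow> X_pow k *s a \<in> W"
  shows "finite_quotient W"
proof -
  have W0: "0 \<in> W" using sub base_zero by blast
  have neg: "- a \<in> W" if "a \<in> W" for a using diff[OF W0 that] by simp
  have add: "a + b \<in> W" if "a \<in> W" "b \<in> W" for a b using diff[OF that(1) neg[OF that(2)]] by simp
  define K where "K = {(c + w, k) |c w k. c \<in> W \<and> (w, k) \<in> V}"
  have KI: "(c + w, k) \<in> K" if "c \<in> W" "(w, k) \<in> V" for c w k using that unfolding K_def by blast
  have "subgroup K lamplighter"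
  proof (rule group.subgroupI[OF group_lamplighter])
    show "K \<noteq> {}" using KI[OF W0 mem_zero] by blast
    fix g assume "g \<in> K"
    then obtain c w k where g: "g = (c + w, k)" "c \<in> W" "(w, k) \<in> V" unfolding K_def by blast
    have "inv\<^bsub>lamplighter\<^esub> g = (- (X_pow (- k) *s c) + (- (X_pow (- k) *s w)), - k)"
      by (simp add: g(1) vector_add_ldistrib)
    also have "\<dots> \<in> K" using mem_inv[OF g(3)] shift[OF mem_inv[OF g(3)] g(2)] neg KI by blast
    finally show "inv\<^bsub>lamplighter\<^esub> g \<in> K" .
    fix h assume "h \<in> K"
    then obtain c' w' k' where h: "h = (c' + w', k')" "c' \<in> W" "(w', k') \<in> V" unfolding K_def by blast
    have "g \<otimes>\<^bsub>lamplighter\<^esub> h = ((c + X_pow k *s c') + (w + X_pow k *s w'), k + k')"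
      by (simp add: g(1) h(1) vector_add_ldistrib algebra_simps)
    also have "\<dots> \<in> K" using mem_mult[OF g(3) h(3)] shift[OF g(3) h(2)] add g(2) KI by blast
    finally show "g \<otimes>\<^bsub>lamplighter\<^esub> h \<in> K" .
  qed simp
  then interpret K: lamplighter_subgroup K by (simp add: lamplighter_subgroup_def)
  have "V \<subseteq> K"
  proof
    fix g assume "g \<in> V"
    then show "g \<in> K" using KI[OF W0, of "fst g" "snd g"] by simp
  qed
  moreover have "base K = W"
  proof
    show "base K \<subseteq> W"
      unfolding base_def K_def using sub add by (auto simp: base_def)
    show "W \<subseteq> base K" using KI[OF _ mem_zero] by (auto simp: base_def)
  qed
  moreover from this have "V \<noteq> K" using sub by auto
  ultimately show ?thesis
    using wm K.subgroup K.finite_index_imp_finite_quotient unfolding weakly_maximal_def by auto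
qed

lemma weakly_maximal_imp_coordinate:
  assumes wm: "weakly_maximal lamplighter V"
    and v: "(v, int s) \<in> V" "s > 0" and dvd: "\<And>w k. (w, k) \<in> V \<Longrightarrow> int s dvd k"
  shows "\<exists>\<phi>. coordinate s (base V) \<phi>"
proof -
  \<comment> \<open>The quotient module M is not formed: \<open>act\<close> is the action on
    representatives, and membership in \<open>?W\<close> means vanishing in M.\<close>
  let ?W = "base V"
  define act where "act f a = subst_X_pow s f *s a" for f :: "'p laurent" and a :: "'p laurent ^ 'n"
  have act_W: "act f a \<in> ?W" if "a \<in> ?W" for f a using base_subst[OF v(1) that] by (simp add: act_def)
  have act_add: "act (f + g) a = act f a + act g a" "act f (a + b) = act f a + act f b" for f g a b
    by (simp_all add: act_def subst_X_pow_add vector_add_ldistrib vector_sadd_rdistrib)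
  have act_diff: "act (f - g) a = act f a - act g a" "act f (a - b) = act f a - act f b" for f g a b
    by (simp_all add: act_def subst_X_pow_diff vector_ssub_ldistrib vector_sub_rdistrib)
  have act_mult: "act (f * g) a = act f (act g a)" for f g a
    by (simp add: act_def subst_X_pow_mult vector_smult_assoc)
  have act_0: "act 0 a = 0" for a by (simp add: act_def)
  have infin: "\<not> finite_quotient ?W"
    using finite_indexI[OF v(1)] v(2) wm by (auto simp: weakly_maximal_def)
  \<comment> \<open>\<open>K a\<close> is the preimage of the cyclic submodule of M generated by
    \<open>a\<close>.\<close>
  define K where "K a = {c + act g a |c g. c \<in> ?W}" for a
  have K_act: "act f b \<in> K a" if "b \<in> K a" for a b f
    using that act_W unfolding K_def by (fastforce simp: act_add act_mult[symmetric])
  have K_diff: "b - b' \<in> K a" if "b \<in> K a" "b' \<in> K a" for a b b'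
  proof -
    obtain c g c' g' where *: "b = c + act g a" "b' = c' + act g' a" "c \<in> ?W" "c' \<in> ?W"
      using \<open>b \<in> K a\<close> \<open>b' \<in> K a\<close> unfolding K_def by blast
    have "b - b' = (c - c') + act (g - g') a" by (simp add: * act_diff)
    with base_diff[OF *(3,4)] show ?thesis unfolding K_def by blast
  qed
  have K_fin: "finite_quotient (K a)" if a: "a \<notin> ?W" for a
  proof (rule weakly_maximal_extension[OF wm])
    have "c \<in> K a" if "c \<in> ?W" for c
      unfolding K_def using that act_0[of a] by (metis (mono_tags, lifting) add.right_neutral mem_Collect_eq)
    moreover have "a \<in> K a"
      unfolding K_def mem_Collect_eq using base_zero
      by (intro exI[of _ 0] exI[of _ 1]) (simp add: act_def)
    ultimately show "?W \<subset> K a" using a by blast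
    show "b - b' \<in> K a" if "b \<in> K a" "b' \<in> K a" for b b' using K_diff that .
    show "X_pow k *s b \<in> K a" if k: "(w, k) \<in> V" and b: "b \<in> K a" for w k b
    proof -
      \<comment> \<open>Every shift in \<open>V\<close> is a multiple of \<open>s\<close>, so it
        acts on M as a power of x and preserves submodules.\<close>
      obtain i where "k = int s * i" using dvd[OF k] by auto
      then show ?thesis using K_act[OF b, of "X_pow i"] by (simp add: act_def)
    qed
  qed
  have torsion_free: "f = 0" if a: "a \<notin> ?W" and f: "act f a \<in> ?W" for f a
  proof (rule ccontr)
    assume "f \<noteq> 0"
    obtain F where F: "finite F" "\<And>g. \<exists>r\<in>F. f dvd g - r"
      using finite_quotient_dvd[OF \<open>f \<noteq> 0\<close>] unfolding finite_quotient_def by auto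
    obtain B where B: "finite B" "\<And>x. \<exists>b\<in>B. x - b \<in> K a"
      using K_fin[OF a] unfolding finite_quotient_def by auto
    \<comment> \<open>Every \<open>x\<close> is \<open>b + g a\<close> modulo \<open>?W\<close>, and
      \<open>g\<close> matters only modulo the annihilator \<open>f\<close>, so finitely many
      \<open>b + r a\<close> represent all of M.\<close>
    let ?C = "(\<lambda>(b, r). b + act r a) ` (B \<times> F)"
    have "\<exists>y\<in>?C. x - y \<in> ?W" for x
    proof -
      obtain b where b: "b \<in> B" "x - b \<in> K a" using B(2) by blast
      then obtain c g where c: "x - b = c + act g a" "c \<in> ?W" unfolding K_def by blast
      obtain r where r: "r \<in> F" "f dvd g - r" using F(2) by blast
      then obtain q where q: "g = r + q * f" by (metis dvd_def mult.commute add_diff_cancel_left' diff_add_cancel add.commute)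
      have "act g a = act r a + act q (act f a)" by (simp only: q act_add act_mult)
      then have "x - (b + act r a) = c + act q (act f a)"
        using c(1) by (simp add: algebra_simps)
      also have "\<dots> \<in> ?W" by (intro base_add c(2) act_W f)
      finally show ?thesis using b(1) r(1) by force
    qed
    then have "finite_quotient ?W"
      unfolding finite_quotient_def using B(1) F(1) by (intro exI[of _ ?C]) simp
    with infin show False by blast
  qed
  have "?W \<noteq> UNIV" using infin finite_quotient_UNIV by auto
  then obtain a where a: "a \<notin> ?W" by blast
  obtain B where B: "finite B" "\<And>x. \<exists>b\<in>B. x - b \<in> K a"
    using K_fin[OF a] unfolding finite_quotient_def by auto
  \<comment> \<open>Infinitely many multiples of \<open>b\<close> fall into finitely many classes
    modulo \<open>K a\<close>; the difference of two coinciding ones gives \<open>f\<close>.\<close>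
  have "\<exists>f. f \<noteq> 0 \<and> act f b \<in> K a" for b
  proof -
    have "\<forall>g. \<exists>c. c \<in> B \<and> act g b - c \<in> K a" using B(2) by blast
    then obtain c where c: "\<And>g. c g \<in> B" "\<And>g. act g b - c g \<in> K a" by metis
    have "\<not> inj c" using c(1) B(1) infinite_laurent by (metis finite_imageD finite_subset image_subsetI)
    then obtain g g' where g: "g \<noteq> g'" "c g = c g'" by (auto simp: inj_def)
    have "act (g - g') b \<in> K a"
      using K_diff[OF c(2)[of g] c(2)[of g']] g(2) by (simp add: act_diff)
    with g(1) show ?thesis by (intro exI[of _ "g - g'"]) simp
  qed
  then obtain d where d: "\<And>b. d b \<noteq> 0" "\<And>b. act (d b) b \<in> K a" by metis
  \<comment> \<open>One multiplier for all classes: the product of those for the finitely many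
    representatives.\<close>
  define f where "f = prod d B"
  have f0: "f \<noteq> 0" using d(1) B(1) by (simp add: f_def)
  have f_K: "act f x \<in> K a" for x
  proof -
    obtain b where b: "b \<in> B" "x - b \<in> K a" using B(2) by blast
    have "f = prod d (B - {b}) * d b"
      unfolding f_def using prod.remove[OF B(1) b(1), of d] by (simp add: mult.commute)
    then have "act f b \<in> K a" using K_act[OF d(2)] by (simp add: act_mult)
    moreover have "- act f (x - b) \<in> K a"
      using K_diff[OF _ K_act[OF b(2), of f], of 0] base_zero by (force simp: K_def act_def intro: exI[of _ 0])
    ultimately have "act f b - (- act f (x - b)) \<in> K a" by (rule K_diff)
    then show ?thesis by (simp add: act_diff)
  qed
  have "\<exists>g. act f x - act g a \<in> ?W" for x
  proof -
    obtain c g where "act f x = c + act g a" "c \<in> ?W" using f_K[of x] unfolding K_def by blast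
    then show ?thesis by (intro exI[of _ g]) simp
  qed
  \<comment> \<open>In M, \<open>f x\<close> equals \<open>\<phi> x\<close> times \<open>a\<close>.
    Torsion-freeness makes this scalar unique, whence linearity.\<close>
  then obtain \<phi> where \<phi>: "\<And>x. act f x - act (\<phi> x) a \<in> ?W" by metis
  have \<phi>_eqI: "\<phi> x = g" if "act f x - act g a \<in> ?W" for x g
  proof -
    have "act (\<phi> x - g) a \<in> ?W" using base_diff[OF that \<phi>[of x]] by (simp add: act_diff)
    from torsion_free[OF a this] show ?thesis by simp
  qed
  have \<phi>_add: "\<phi> (x + y) = \<phi> x + \<phi> y" for x y
    using base_add[OF \<phi>[of x] \<phi>[of y]] by (intro \<phi>_eqI) (simp add: act_add algebra_simps)
  have \<phi>_act: "\<phi> (act g x) = g * \<phi> x" for g x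
    using act_W[OF \<phi>[of x], of g]
    by (intro \<phi>_eqI) (simp add: act_diff act_mult[symmetric] mult.commute)
  have \<phi>_0: "\<phi> x = 0 \<longleftrightarrow> x \<in> ?W" for x
  proof
    assume "\<phi> x = 0"
    then have "act f x \<in> ?W" using \<phi>[of x] by (simp add: act_0)
    then show "x \<in> ?W" using torsion_free f0 by blast
  next
    assume "x \<in> ?W"
    then show "\<phi> x = 0" using act_W by (intro \<phi>_eqI) (simp add: act_0)
  qed
  have \<phi>_diff: "\<phi> (x - y) = \<phi> x - \<phi> y" for x y using \<phi>_add[of "x - y" y] by (simp add: algebra_simps)
  \<comment> \<open>The image of \<phi> is in general only a nonzero ideal; dividing by its
    generator \<open>h\<close> makes the map surjective.\<close>
  obtain h where h: "h \<noteq> 0" "range \<phi> = range (\<lambda>q. q * h)"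
  proof (rule laurent_ideal_principal)
    show "g - g' \<in> range \<phi>" if "g \<in> range \<phi>" "g' \<in> range \<phi>" for g g'
      using that by (auto simp flip: \<phi>_diff)
    show "q * g \<in> range \<phi>" if "g \<in> range \<phi>" for q g
      using that by (auto simp flip: \<phi>_act)
    show "\<phi> a \<in> range \<phi>" by simp
    show "\<phi> a \<noteq> 0" using a by (simp add: \<phi>_0)
  qed
  have "\<forall>x. \<exists>q. \<phi> x = q * h" using h(2) by blast
  then obtain \<psi> where \<psi>: "\<And>x. \<phi> x = \<psi> x * h" by metis
  have \<psi>_eqI: "\<psi> x = q" if "\<phi> x = q * h" for x q using that h(1) by (simp add: \<psi>)
  have "surj \<psi>"
    unfolding surj_def
  proof
    fix q
    have "q * h \<in> range \<phi>" unfolding h(2) by blast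
    then obtain x where "\<phi> x = q * h" by auto
    from \<psi>_eqI[OF this] show "\<exists>x. q = \<psi> x" by blast
  qed
  moreover have "\<psi> (x + y) = \<psi> x + \<psi> y" for x y
    by (rule \<psi>_eqI) (simp add: \<phi>_add distrib_right flip: \<psi>)
  moreover have "\<psi> (act g x) = g * \<psi> x" for g x
    by (rule \<psi>_eqI) (simp add: \<phi>_act mult.assoc flip: \<psi>)
  moreover have "\<psi> x = 0 \<longleftrightarrow> x \<in> ?W" for x
    using \<psi>[of x] h(1) by (simp flip: \<phi>_0)
  ultimately show ?thesis
    unfolding coordinate_def act_def by blast
qed

lemma coordinate_imp_weakly_maximal:
  assumes \<phi>: "coordinate s (base V) \<phi>" and v: "(v, int s) \<in> V" "s > 0"
    and dvd: "\<And>w k. (w, k) \<in> V \<Longrightarrow> int s dvd k"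
  shows "weakly_maximal lamplighter V"
  unfolding weakly_maximal_def
proof (intro conjI allI impI)
  show "subgroup V lamplighter" by (rule subgroup)
  show "\<not> finite_index lamplighter V"
    using coordinate_not_finite_quotient[OF \<phi>] finite_index_imp_finite_quotient by blast
  fix K assume K: "subgroup K lamplighter \<and> V \<subset> K"
  then interpret K: lamplighter_subgroup K by (simp add: lamplighter_subgroup_def)
  have VK: "base V \<subseteq> base K" using K by (auto simp: base_def)
  have vK: "(v, int s) \<in> K" using v K by blast
  have "base K \<noteq> base V"
  proof
    assume eq: "base K = base V"
    have "g \<in> V" if g: "g \<in> K" for g
    proof -
      obtain w k where wk: "g = (w, k)" by (cases g)
      \<comment> \<open>\<open>K\<close> has an element of shift \<open>t\<close>, so the common
        base is invariant under \<open>x^t\<close>; rigidity then gives \<open>t = s\<close>, hence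
        \<open>s\<close> divides \<open>k\<close>.\<close>
      define t where "t = nat (gcd k (int s))"
      have t: "int t = gcd k (int s)" by (simp add: t_def)
      obtain u where u: "(u, int t) \<in> K" using K.mem_gcd[OF _ vK] g unfolding wk t by blast
      have "int t dvd int s" by (simp add: t)
      then obtain m where m: "s = t * m" by auto
      have "m = 1"
        using coordinate_shift_invariant[OF \<phi> m] K.base_shift[OF u] by (simp add: eq)
      then have "int s dvd k" using m t by (metis gcd_dvd1 mult.right_neutral)
      then obtain u where u: "(u, k) \<in> V" using mem_multiple[OF v(1)] by (auto elim!: dvdE)
      have "w - u \<in> base V" using K.diff_mem_base[of w k u] g u K unfolding wk eq by blast
      from mem_add_base[OF this u] show ?thesis by (simp add: wk)
    qed
    with K show False by blast
  qed
  then obtain a where a: "a \<in> base K" "a \<notin> base V" using VK by blast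
  then have "\<phi> a \<noteq> 0" by (simp add: coordinateD(4)[OF \<phi>])
  \<comment> \<open>The base of \<open>K\<close> contains \<open>V_0\<close> and all multiples of
    \<open>a\<close>, so its quotient is an image of R modulo \<open>\<phi> a\<close>. Lifting
    remainders through \<phi> gives representatives.\<close>
  from finite_quotient_dvd[OF this] obtain F where F: "finite F" "\<And>g. \<exists>r\<in>F. \<phi> a dvd g - r"
    unfolding finite_quotient_def by auto
  define c where "c r = (SOME b. \<phi> b = r)" for r
  have c: "\<phi> (c r) = r" for r
    unfolding c_def using coordinate_preimage[OF \<phi>] by (metis (mono_tags) someI_ex)
  have "\<exists>y\<in>c ` F. x - y \<in> base K" for x
  proof -
    obtain r q where r: "r \<in> F" "\<phi> x - r = \<phi> a * q" using F(2)[of "\<phi> x"] by (auto elim!: dvdE)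
    then have "\<phi> (x - c r - subst_X_pow s q *s a) = 0"
      by (simp add: coordinateD(2,3)[OF \<phi>] c)
    then have "x - c r - subst_X_pow s q *s a \<in> base K"
      using VK by (auto simp: coordinateD(4)[OF \<phi>])
    from K.base_add[OF this K.base_subst[OF vK a(1), of q]] show ?thesis using r(1) by auto
  qed
  then have "finite_quotient (base K)"
    unfolding finite_quotient_def using F(1) by (intro exI[of _ "c ` F"]) simp
  then show "finite_index lamplighter K"
    using K.finite_indexI[OF vK] v(2) by simp
qed

end

section \<open>Closed subgroups\<close>

text \<open>For \<open>q > 0\<close> this is the kernel of the reduction onto the finite wreath
  product of \<open>(Z/p)^n\<close> with \<open>Z/q\<close>, whose base is
  \<open>(R/(x^q - 1))^n\<close>.\<close>

definition congruence_subgroup :: "int \<Rightarrow> ((('p::prime_card laurent) ^ 'n) \<times> int) set" where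
  "congruence_subgroup q = {(b, i). (\<exists>c. b = (X_pow q - 1) *s c) \<and> q dvd i}"

lemma congruence_subgroupI: "q dvd i \<Longrightarrow> ((X_pow q - 1) *s c, i) \<in> congruence_subgroup q"
  unfolding congruence_subgroup_def by blast

lemma subgroup_congruence_subgroup: "subgroup (congruence_subgroup q) lamplighter"
proof (rule group.subgroupI[OF group_lamplighter])
  show "congruence_subgroup q \<noteq> {}" unfolding congruence_subgroup_def by fastforce
  fix g h :: "('a laurent ^ 'b) \<times> int"
  assume "g \<in> congruence_subgroup q"
  then obtain c i where g: "g = ((X_pow q - 1) *s c, i)" "q dvd i"
    unfolding congruence_subgroup_def by blast
  have "inv\<^bsub>lamplighter\<^esub> g = ((X_pow q - 1) *s (- (X_pow (- i) *s c)), - i)"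
    by (simp add: g(1) vector_smult_assoc mult.commute)
  then show "inv\<^bsub>lamplighter\<^esub> g \<in> congruence_subgroup q"
    using g(2) by (simp only: congruence_subgroupI dvd_minus_iff)
  assume "h \<in> congruence_subgroup q"
  then obtain d j where h: "h = ((X_pow q - 1) *s d, j)" "q dvd j"
    unfolding congruence_subgroup_def by blast
  have "g \<otimes>\<^bsub>lamplighter\<^esub> h = ((X_pow q - 1) *s (c + X_pow i *s d), i + j)"
    by (simp add: g(1) h(1) vector_smult_assoc vector_add_ldistrib mult.commute)
  then show "g \<otimes>\<^bsub>lamplighter\<^esub> h \<in> congruence_subgroup q"
    using g(2) h(2) by (simp only: congruence_subgroupI dvd_add)
qed simp

lemma X_pow_minus_one_smult:
  fixes a :: "'p::prime_card laurent ^ 'n"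
  assumes "q dvd i"
  shows "\<exists>c. (X_pow i - 1) *s a = (X_pow q - 1) *s c"
proof -
  obtain k where "i = q * k" using assms ..
  then obtain f where "X_pow i - 1 = (X_pow q - 1) * (f :: 'p laurent)"
    using X_pow_minus_one_dvd by (metis dvdE)
  then have "(X_pow i - 1) *s a = (X_pow q - 1) *s (f *s a)" by (simp add: vector_smult_assoc)
  then show ?thesis by blast
qed

text \<open>Conjugation by \<open>(a, k)\<close> contributes a term \<open>(x^i - 1) a\<close>, with
  \<open>i\<close> the shift of the conjugated element; \<open>q\<close> divides
  \<open>i\<close>.\<close>

lemma normal_congruence_subgroup: "congruence_subgroup q \<lhd> lamplighter"
  unfolding group.normal_inv_iff[OF group_lamplighter]
proof (intro conjI ballI)
  show "subgroup (congruence_subgroup q) lamplighter" by (rule subgroup_congruence_subgroup)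
  fix x g :: "('a laurent ^ 'b) \<times> int" assume "g \<in> congruence_subgroup q"
  then obtain c i where g: "g = ((X_pow q - 1) *s c, i)" "q dvd i"
    unfolding congruence_subgroup_def by blast
  obtain a k where x: "x = (a, k)" by (cases x)
  obtain d where d: "(X_pow i - 1) *s a = (X_pow q - 1) *s d"
    using X_pow_minus_one_smult[OF g(2)] by blast
  have "x \<otimes>\<^bsub>lamplighter\<^esub> g \<otimes>\<^bsub>lamplighter\<^esub> inv\<^bsub>lamplighter\<^esub> x
      = (X_pow k *s ((X_pow q - 1) *s c) - (X_pow i - 1) *s a, i)"
    by (simp add: x g(1) X_pow_vec_assoc vector_sub_rdistrib)
  also have "\<dots> = ((X_pow q - 1) *s (X_pow k *s c - d), i)"
    unfolding d by (simp add: vector_smult_assoc vector_ssub_ldistrib mult.commute)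
  finally show "x \<otimes>\<^bsub>lamplighter\<^esub> g \<otimes>\<^bsub>lamplighter\<^esub> inv\<^bsub>lamplighter\<^esub> x \<in> congruence_subgroup q"
    using g(2) by (simp only: congruence_subgroupI)
qed

lemma lamplighter_pow:
  "\<exists>b. (a, k) [^]\<^bsub>lamplighter\<^esub> (m :: nat) = (b, k * int m)"
proof -
  interpret L: group "lamplighter :: ((('a::prime_card laurent) ^ 'b) \<times> int) monoid"
    by (rule group_lamplighter)
  show ?thesis by (induction m) (auto simp: algebra_simps)
qed

text \<open>The first component of the power is the sum of \<open>x^(l i) b\<close> over
  \<open>i < m\<close>, and each \<open>x^(l i)\<close> is 1 modulo \<open>x^q - 1\<close>. For
  \<open>m = p\<close> the main term vanishes.\<close>

lemma lamplighter_pow_cong: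
  fixes b :: "'p::prime_card laurent ^ 'n"
  assumes "q dvd l"
  shows "\<exists>c. (b, l) [^]\<^bsub>lamplighter\<^esub> (m :: nat) = (of_nat m *s b + (X_pow q - 1) *s c, l * int m)"
proof -
  interpret L: group "lamplighter :: ((('p::prime_card laurent) ^ 'n) \<times> int) monoid"
    by (rule group_lamplighter)
  show ?thesis
  proof (induction m)
    case 0
    show ?case by (auto intro!: exI[of _ 0])
  next
    case (Suc m)
    then obtain c where c: "(b, l) [^]\<^bsub>lamplighter\<^esub> m = (of_nat m *s b + (X_pow q - 1) *s c, l * int m)" by blast
    have "q dvd l * int m" using assms by simp
    from X_pow_minus_one_smult[OF this, of b] obtain d
      where d: "(X_pow (l * int m) - 1) *s b = (X_pow q - 1) *s d" by blast
    have "X_pow (l * int m) *s b = b + (X_pow q - 1) *s d"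
      unfolding d[symmetric] by (simp add: vector_sub_rdistrib)
    then have "(b, l) [^]\<^bsub>lamplighter\<^esub> Suc m = (of_nat (Suc m) *s b + (X_pow q - 1) *s (c + d), l * int (Suc m))"
      using c by (simp add: vector_add_ldistrib vector_sadd_rdistrib algebra_simps)
    then show ?case by blast
  qed
qed

text \<open>Raising to the power \<open>p^j\<close> makes the shift divisible by the level, and a
  further p-th power lands in the subgroup by characteristic p. So the finite quotient has exponent
  dividing \<open>p^(j+1)\<close>.\<close>

lemma normal_p_power_index_congruence_subgroup:
  "normal_p_power_index CARD('p) lamplighter
     (congruence_subgroup (int (CARD('p) ^ j)) :: ((('p::prime_card laurent) ^ 'n) \<times> int) set)"
proof -
  let ?p = "CARD('p)" let ?q = "int (?p ^ j)"
  let ?G = "lamplighter :: ((('p::prime_card laurent) ^ 'n) \<times> int) monoid"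
  let ?N = "congruence_subgroup ?q :: ((('p::prime_card laurent) ^ 'n) \<times> int) set"
  have p: "prime ?p" by (rule prime_card)
  then have q0: "?q > 0" by (simp add: prime_gt_0_nat)
  interpret G: group ?G by (rule group_lamplighter)
  interpret N: normal ?N ?G by (rule normal_congruence_subgroup)
  interpret L: lamplighter_subgroup ?N
    using subgroup_congruence_subgroup by (simp add: lamplighter_subgroup_def)
  have "finite_quotient {a :: 'p laurent ^ 'n. \<exists>b. a = (X_pow ?q - 1) *s b}"
    by (rule finite_quotient_smult) (rule X_pow_minus_one_neq_0[OF q0])
  then have "finite_quotient (base ?N)"
    by (simp add: base_def congruence_subgroup_def)
  moreover have "(0, ?q) \<in> ?N" by (auto simp: congruence_subgroup_def intro!: exI[of _ 0])
  ultimately have fin: "finite (rcosets\<^bsub>?G\<^esub> ?N)"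
    using L.finite_indexI q0 by (fastforce simp: finite_index_def)
  have "\<exists>k. card (carrier (?G Mod ?N)) = ?p ^ k"
  proof (rule card_prime_power[OF N.factorgroup_is_group _ p])
    show "finite (carrier (?G Mod ?N))" using fin by (simp add: FactGroup_def)
    fix x assume "x \<in> carrier (?G Mod ?N)"
    then obtain g where x: "x = ?N #>\<^bsub>?G\<^esub> g" by (auto simp: FactGroup_def RCOSETS_def)
    obtain a k where g: "g = (a, k)" by (cases g)
    obtain b where b: "g [^]\<^bsub>?G\<^esub> (?p ^ j) = (b, k * ?q)" using lamplighter_pow[of a k] unfolding g by blast
    obtain c where c: "(b, k * ?q) [^]\<^bsub>?G\<^esub> ?p = (of_nat ?p *s b + (X_pow ?q - 1) *s c, k * ?q * int ?p)"
      using lamplighter_pow_cong[of ?q "k * ?q" b ?p] by auto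
    have "(of_nat ?p :: 'p laurent) = 0"
      by (metis of_nat_card_eq_0 single_of_nat single_zero)
    then have "g [^]\<^bsub>?G\<^esub> (?p ^ Suc j) = ((X_pow ?q - 1) *s c, k * ?q * int ?p)"
      using b c by (simp flip: G.nat_pow_pow add: mult.commute[of ?p])
    then have "g [^]\<^bsub>?G\<^esub> (?p ^ Suc j) \<in> ?N" by (auto simp: congruence_subgroup_def)
    then have "x [^]\<^bsub>?G Mod ?N\<^esub> (?p ^ Suc j) = ?N"
      using N.FactGroup_pow[of g "?p ^ Suc j"] N.rcos_const[OF G.is_group] by (simp add: x)
    then show "\<exists>e. x [^]\<^bsub>?G Mod ?N\<^esub> (?p ^ e) = \<one>\<^bsub>?G Mod ?N\<^esub>"
      by (intro exI[of _ "Suc j"]) simp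
  qed
  then show ?thesis
    using normal_congruence_subgroup by (simp add: normal_p_power_index_def FactGroup_def)
qed

lemma closedin_pro_p_topology_iff:
  fixes V :: "((('p::prime_card laurent) ^ 'n) \<times> int) set"
  shows "closedin (pro_p_topology CARD('p) lamplighter) V \<longleftrightarrow>
    (\<forall>g. g \<notin> V \<longrightarrow> (\<exists>N. normal_p_power_index CARD('p) lamplighter N \<and> (g <#\<^bsub>lamplighter\<^esub> N) \<inter> V = {}))"
  unfolding closedin_def topspace_pro_p_topology[OF prime_card group_lamplighter]
    openin_pro_p_topology[OF prime_card group_lamplighter] pro_p_open_def
  by (auto simp: disjoint_eq_subset_Compl Compl_eq_Diff_UNIV)

section \<open>Separating a subgroup from its complement\<close>

context lamplighter_subgroup
begin

text \<open>Modulo any \<open>N\<close> of index \<open>p^e\<close>, multiplication by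
  \<open>x^(p^e)\<close> is trivial, while \<open>V_0\<close> is invariant under \<open>x^s\<close>.
  Combining the two reaches \<open>x^t a\<close> from an element of \<open>V_0\<close>, so no
  neighbourhood of it avoids \<open>V\<close>.\<close>

lemma closed_imp_shift_invariant:
  assumes closed: "closedin (pro_p_topology CARD('p) lamplighter) V"
    and v: "(v, int s) \<in> V" and s: "s = CARD('p) ^ k * m" "coprime CARD('p) m"
    and a: "a \<in> base V"
  shows "X_pow (int (CARD('p) ^ k)) *s a \<in> base V"
proof (rule ccontr)
  let ?p = "CARD('p)" and ?G = "lamplighter :: ((('p::prime_card laurent) ^ 'n) \<times> int) monoid"
  let ?t = "int (?p ^ k)"
  assume "X_pow ?t *s a \<notin> base V"
  then have "(X_pow ?t *s a, 0) \<notin> V" by (simp add: base_def)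
  then obtain N where N: "normal_p_power_index ?p ?G N" and disj: "((X_pow ?t *s a, 0) <#\<^bsub>?G\<^esub> N) \<inter> V = {}"
    using closed unfolding closedin_pro_p_topology_iff by blast
  interpret G: group ?G by (rule group_lamplighter)
  interpret N: normal N ?G using N by (simp add: normal_p_power_index_def)
  interpret L: lamplighter_subgroup N by (simp add: lamplighter_subgroup_def N.subgroup_axioms)
  obtain e where e: "card (rcosets\<^bsub>?G\<^esub> N) = ?p ^ e" using N by (auto simp: normal_p_power_index_def)
  have pow: "(0, 1) [^]\<^bsub>?G\<^esub> (i :: nat) = (0, int i)" for i by (induction i) auto
  have "(N #>\<^bsub>?G\<^esub> (0, 1)) [^]\<^bsub>?G Mod N\<^esub> (?p ^ e) = \<one>\<^bsub>?G Mod N\<^esub>"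
    using group.pow_order_eq_1[OF N.factorgroup_is_group, of "N #>\<^bsub>?G\<^esub> (0, 1)"]
    by (simp add: Coset.order_def FactGroup_def RCOSETS_def flip: e) (use e in \<open>auto simp: RCOSETS_def\<close>)
  then have "N #>\<^bsub>?G\<^esub> (0, int (?p ^ e)) = N"
    using N.FactGroup_pow[of "(0, 1)" "?p ^ e"] by (simp add: pow)
  then have pe: "(0, int (?p ^ e)) \<in> N"
    using G.coset_join1 N.subgroup_axioms by fastforce
  \<comment> \<open>As \<open>m\<close> is prime to p, this holds for every \<open>e\<close>, and
    the p-part of \<open>s\<close> becomes an integral combination of \<open>s\<close> and
    \<open>p^e\<close>.\<close>
  have "gcd s (?p ^ e) dvd ?p ^ k"
    using s(2) unfolding s(1)
    by (metis coprime_commute coprime_dvd_mult_left_iff coprime_power_right_iff gcd_dvd1 gcd_dvd2 coprime_divisors dvd_refl)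
  then have "gcd (int s) (int (?p ^ e)) dvd ?t" by (metis gcd_int_int_eq of_nat_dvd_iff)
  then obtain l where l: "?t = gcd (int s) (int (?p ^ e)) * l" ..
  obtain x0 y0 where "x0 * int s + y0 * int (?p ^ e) = gcd (int s) (int (?p ^ e))"
    using bezout_int by blast
  with l have "?t = (x0 * int s + y0 * int (?p ^ e)) * l" by (simp only:)
  also have "\<dots> = int s * (x0 * l) + int (?p ^ e) * (y0 * l)" by (simp only: algebra_simps)
  finally have "?t = int s * (x0 * l) + int (?p ^ e) * (y0 * l)" .
  then obtain x y where xy: "?t = int s * x + int (?p ^ e) * y" by blast
  obtain w where w: "(w, int s * x) \<in> V" using mem_multiple[OF v] by blast
  define b where "b = X_pow (int s * x) *s a"
  let ?d = "int (?p ^ e) * y"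
  have d: "(0, ?d) \<in> N" by (rule L.mem_zero_multiple[OF pe])
  have "(b, 0) \<in> V" using base_shift[OF w a] by (simp add: b_def base_def)
  \<comment> \<open>The commutator of \<open>(b, 0)\<close> with \<open>(0, ?d)\<close> lies in
    \<open>N\<close>; its first component is \<open>b - x^d b\<close>, and \<open>x^d b\<close> is
    \<open>x^t a\<close>.\<close>
  have "(b, 0) \<otimes>\<^bsub>?G\<^esub> (0, ?d) \<otimes>\<^bsub>?G\<^esub> inv\<^bsub>?G\<^esub> (b, 0) \<in> N"
    using N.inv_op_closed2[OF _ d, of "(b, 0)"] by simp
  then have "(b - X_pow ?d *s b, ?d) \<in> N" by simp
  from L.mem_mult[OF this L.mem_inv[OF d]] have "(b - X_pow ?t *s a, 0) \<in> N"
    by (simp add: b_def X_pow_vec_assoc xy add.commute del: of_nat_power)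
  moreover have "(X_pow ?t *s a, 0) \<otimes>\<^bsub>?G\<^esub> (b - X_pow ?t *s a, 0) = (b, 0)" by simp
  ultimately have "(b, 0) \<in> (X_pow ?t *s a, 0) <#\<^bsub>?G\<^esub> N" unfolding l_coset_def by fastforce
  with disj \<open>(b, 0) \<in> V\<close> show False by blast
qed

lemma coordinate_imp_closed:
  assumes \<phi>: "coordinate s (base V) \<phi>" and v: "(v, int s) \<in> V"
    and dvd: "\<And>w k. (w, k) \<in> V \<Longrightarrow> int s dvd k" and s: "s = CARD('p) ^ k"
  shows "closedin (pro_p_topology CARD('p) lamplighter) V"
  unfolding closedin_pro_p_topology_iff
proof (intro allI impI)
  let ?p = "CARD('p)"
  have p: "prime ?p" by (rule prime_card)
  have s0: "s > 0" using p by (simp add: s prime_gt_0_nat)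
  fix g assume g: "g \<notin> V"
  obtain a i where ai: "g = (a, i)" by (cases g)
  have mult: "g \<otimes>\<^bsub>lamplighter\<^esub> h = (a + X_pow i *s fst h, i + snd h)" for h
    by (cases h) (simp add: ai)
  show "\<exists>N. normal_p_power_index ?p lamplighter N \<and> (g <#\<^bsub>lamplighter\<^esub> N) \<inter> V = {}"
  proof (cases "int s dvd i")
    case False
    have "(g <#\<^bsub>lamplighter\<^esub> congruence_subgroup (int s)) \<inter> V = {}"
    proof (rule ccontr)
      assume "(g <#\<^bsub>lamplighter\<^esub> congruence_subgroup (int s)) \<inter> V \<noteq> {}"
      then obtain h where "h \<in> congruence_subgroup (int s)" "g \<otimes>\<^bsub>lamplighter\<^esub> h \<in> V"
        unfolding l_coset_def by blast
      then have "int s dvd snd h" "int s dvd i + snd h"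
        unfolding mult by (auto simp: congruence_subgroup_def dest: dvd)
      then show False using False by (simp add: dvd_add_left_iff)
    qed
    then show ?thesis using normal_p_power_index_congruence_subgroup[of k] by (auto simp: s)
  next
    case True
    then obtain w where w: "(w, i) \<in> V" using mem_multiple[OF v] by (auto elim!: dvdE)
    \<comment> \<open>\<open>g\<close> is the product of \<open>(w, i)\<close> and
      \<open>(a', 0)\<close>, so everything reduces to separating \<open>a'\<close> from
      \<open>V_0\<close>.\<close>
    define a' where "a' = X_pow (- i) *s (a - w)"
    have "a' \<notin> base V"
    proof
      assume "a' \<in> base V"
      from base_shift[OF w this] have "a - w \<in> base V" by (simp add: a'_def X_pow_vec_assoc)
      from mem_add_base[OF this w] show False using g by (simp add: ai)
    qed
    \<comment> \<open>If the chosen coset met \<open>V\<close>, this nonzero polynomial would be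
      divisible by \<open>x^(p^j) - 1\<close>, which is impossible for large
      \<open>j\<close>.\<close>
    then have "(X_pow 1 - 1) * \<phi> a' \<noteq> 0"
      using X_pow_minus_one_neq_0[of 1] by (simp add: coordinateD(4)[OF \<phi>])
    then obtain M where M: "\<And>m. m > M \<Longrightarrow> \<not> (X_pow m - 1) dvd (X_pow 1 - 1) * \<phi> a'"
      using not_X_pow_minus_one_dvd by blast
    define j where "j = nat M"
    have "nat M < ?p ^ j" unfolding j_def by (rule power_gt_expt[OF prime_gt_Suc_0_nat[OF p]])
    then have j: "int (?p ^ j) > M" by linarith
    \<comment> \<open>The level \<open>s * p^j\<close> is a power of p because \<open>s\<close> is,
      and \<open>x\<close> to this level acts on the module as \<open>x^(p^j)\<close>.\<close>
    let ?N = "congruence_subgroup (int (?p ^ (k + j))) :: ((('p laurent) ^ 'n) \<times> int) set"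
    have q: "int (?p ^ (k + j)) = int s * int (?p ^ j)" by (simp add: s power_add)
    have "(g <#\<^bsub>lamplighter\<^esub> ?N) \<inter> V = {}"
    proof (rule ccontr)
      assume "(g <#\<^bsub>lamplighter\<^esub> ?N) \<inter> V \<noteq> {}"
      then obtain h where h: "h \<in> ?N" "g \<otimes>\<^bsub>lamplighter\<^esub> h \<in> V"
        unfolding l_coset_def by blast
      then obtain c d where hc: "h = ((X_pow (int s * int (?p ^ j)) - 1) *s c, int s * int (?p ^ j) * d)"
        unfolding congruence_subgroup_def q by (auto elim!: dvdE)
      define b where "b = (X_pow (int s * int (?p ^ j)) - 1) *s c"
      have "(a + X_pow i *s b, i + int s * (int (?p ^ j) * d)) \<in> V"
        using h(2) unfolding mult by (simp add: hc b_def mult.assoc)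
      from mem_mult[OF mem_inv[OF w] this] have "(a' + b, int s * (int (?p ^ j) * d)) \<in> V"
        by (simp add: a'_def vector_ssub_ldistrib vector_add_ldistrib X_pow_vec_assoc diff_add_eq)
      \<comment> \<open>The element need not have zero shift, so \<open>a' + b\<close> need not lie
        in \<open>V_0\<close>; commuting with \<open>(v, s)\<close> yields a relation in the base at
        the cost of a factor \<open>x - 1\<close>.\<close>
      from commutator_mem_base[OF this v]
      have "subst_X_pow s (X_pow 1 - 1) *s (a' + b) - subst_X_pow s (X_pow (int (?p ^ j) * d) - 1) *s v \<in> base V"
        by (simp add: subst_X_pow_diff)
      then have "\<phi> (subst_X_pow s (X_pow 1 - 1) *s (a' + b) - subst_X_pow s (X_pow (int (?p ^ j) * d) - 1) *s v) = 0"
        by (simp add: coordinateD(4)[OF \<phi>])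
      then have "(X_pow 1 - 1) * (\<phi> a' + \<phi> b) = (X_pow (int (?p ^ j) * d) - 1) * \<phi> v"
        by (simp add: coordinateD(1-3)[OF \<phi>])
      then have eq: "(X_pow 1 - 1) * \<phi> a' = (X_pow (int (?p ^ j) * d) - 1) * \<phi> v - (X_pow 1 - 1) * \<phi> b"
        by (simp add: algebra_simps)
      have "b = subst_X_pow s (X_pow (int (?p ^ j)) - 1) *s c"
        by (simp add: b_def subst_X_pow_diff)
      then have "\<phi> b = (X_pow (int (?p ^ j)) - 1) * \<phi> c" by (simp add: coordinateD(3)[OF \<phi>])
      then have "(X_pow (int (?p ^ j)) - 1) dvd (X_pow 1 - 1) * \<phi> a'"
        unfolding eq using X_pow_minus_one_dvd[of "int (?p ^ j)" d]
        by (intro dvd_diff[OF dvd_mult2 dvd_mult]) simp_all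
      with M[OF j] show False by simp
    qed
    then show ?thesis using normal_p_power_index_congruence_subgroup[of "k + j"] by blast
  qed
qed

end

theorem theorem3p12:
  fixes V :: "((('p::prime_card laurent) ^ 'n) \<times> int) set"
    and s :: nat and V0 :: "('p laurent ^ 'n) set" and v :: "'p laurent ^ 'n"
  assumes "subgroup V lamplighter"
    and "triple V s V0 v"
  shows "(weakly_maximal lamplighter V \<longleftrightarrow>
            (s = 0 \<and> V0 = UNIV) \<or>
            (s > 0 \<and> module_isomorphic laurent_ring (factor_module (lamp_module s) V0) laurent_module))
       \<and> (weakly_maximal lamplighter V \<longrightarrow>
            (closedin (pro_p_topology CARD('p) lamplighter) V \<longleftrightarrow>
               s = 0 \<or> (\<exists>k. s = CARD('p) ^ k)))"
proof -
  interpret lamplighter_subgroup V using assms(1) by (simp add: lamplighter_subgroup_def)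
  let ?p = "CARD('p)"
  have p: "prime ?p" by (rule prime_card)
  have V0: "V0 = base V" and v: "(v, int s) \<in> V" and im: "snd ` V = {int s * k |k. True}"
    using assms(2) by (auto simp: triple_def base_def)
  have dvd: "int s dvd k" if "(w, k) \<in> V" for w k
    using imageI[OF that, of snd] unfolding im by auto
  show ?thesis
  proof (cases "s = 0")
    case s: True
    have V_A: "V \<subseteq> {g. snd g = 0}" using dvd s by force
    have wm: "weakly_maximal lamplighter V \<longleftrightarrow> V0 = UNIV"
    proof
      assume wm: "weakly_maximal lamplighter V"
      \<comment> \<open>\<open>V\<close> lies in \<A>\<open>\<^sub>n\<close>, which itself has
        infinite index, so weak maximality forces equality.\<close>
      have A: "subgroup {g :: ('p laurent ^ 'n) \<times> int. snd g = 0} lamplighter"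
        by (rule group.subgroupI[OF group_lamplighter]) auto
      then interpret A: lamplighter_subgroup "{g :: ('p laurent ^ 'n) \<times> int. snd g = 0}"
        by (simp add: lamplighter_subgroup_def)
      have "\<not> finite_index lamplighter {g :: ('p laurent ^ 'n) \<times> int. snd g = 0}"
        using A.finite_index_imp_shift by auto
      then have "V = {g. snd g = 0}" using wm A V_A unfolding weakly_maximal_def by blast
      then show "V0 = UNIV" by (auto simp: V0 base_def)
    next
      assume "V0 = UNIV"
      then have V: "(a, 0) \<in> V" for a by (auto simp: V0 base_def)
      show "weakly_maximal lamplighter V"
        unfolding weakly_maximal_def
      proof (intro conjI allI impI)
        show "subgroup V lamplighter" by (rule assms)
        show "\<not> finite_index lamplighter V" using finite_index_imp_shift V_A by force
        fix K assume K: "subgroup K lamplighter \<and> V \<subset> K"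
        then interpret K: lamplighter_subgroup K by (simp add: lamplighter_subgroup_def)
        obtain w k where wk: "(w, k) \<in> K" "(w, k) \<notin> V" using K by auto
        then have "k \<noteq> 0" using V by auto
        moreover have "base K = UNIV" using K V by (auto simp: base_def)
        ultimately show "finite_index lamplighter K"
          using K.finite_indexI[OF wk(1)] finite_quotient_UNIV by simp
      qed
    qed
    have "closedin (pro_p_topology ?p lamplighter) V" if "V0 = UNIV"
      unfolding closedin_pro_p_topology_iff
    proof (intro allI impI)
      fix g assume "g \<notin> V"
      obtain a i where g: "g = (a, i)" by (cases g)
      have V: "(b, 0) \<in> V" for b using that by (auto simp: V0 base_def)
      have i: "i \<noteq> 0" using \<open>g \<notin> V\<close> V by (auto simp: g)
      \<comment> \<open>Since \<open>p^j > j\<close>, this level exceeds the nonzero shift of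
        \<open>g\<close> in absolute value, and so the congruence subgroup detects it.\<close>
      define j where "j = nat \<bar>i\<bar>"
      have "nat \<bar>i\<bar> < ?p ^ j" unfolding j_def by (rule power_gt_expt[OF prime_gt_Suc_0_nat[OF p]])
      then have "int (?p ^ j) > \<bar>i\<bar>" by linarith
      then have "\<not> int (?p ^ j) dvd i" using i zdvd_imp_le[of "int (?p ^ j)" "\<bar>i\<bar>"] by auto
      then have "(g <#\<^bsub>lamplighter\<^esub> congruence_subgroup (int (?p ^ j))) \<inter> V = {}"
        using V_A by (force simp: l_coset_def congruence_subgroup_def g add_eq_0_iff)
      then show "\<exists>N. normal_p_power_index ?p lamplighter N \<and> (g <#\<^bsub>lamplighter\<^esub> N) \<inter> V = {}"
        using normal_p_power_index_congruence_subgroup[of j] by blast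
    qed
    then show ?thesis using s wm by simp
  next
    case False
    then have s: "s > 0" by simp
    have iso: "module_isomorphic laurent_ring (factor_module (lamp_module s) V0) laurent_module
        \<longleftrightarrow> (\<exists>\<phi>. coordinate s (base V) \<phi>)"
      using module_isomorphic_iff_coordinate[OF submodule_triple[OF assms]] by (simp add: V0)
    have wm: "weakly_maximal lamplighter V \<longleftrightarrow> (\<exists>\<phi>. coordinate s (base V) \<phi>)"
      using weakly_maximal_imp_coordinate[OF _ v s] coordinate_imp_weakly_maximal[OF _ v s] dvd by blast
    have "closedin (pro_p_topology ?p lamplighter) V \<longleftrightarrow> (\<exists>k. s = ?p ^ k)" if \<phi>: "coordinate s (base V) \<phi>" for \<phi>
    proof
      assume "\<exists>k. s = ?p ^ k"
      then show "closedin (pro_p_topology ?p lamplighter) V"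
        using coordinate_imp_closed[OF \<phi> v] dvd by blast
    next
      assume closed: "closedin (pro_p_topology ?p lamplighter) V"
      \<comment> \<open>\<open>m\<close> is the part of \<open>s\<close> prime to p; closedness
        gives invariance of \<open>V_0\<close> under the complementary p-part, and rigidity forces
        \<open>m = 1\<close>.\<close>
      obtain m where m: "s = ?p ^ multiplicity ?p s * m" "\<not> ?p dvd m"
        using multiplicity_decompose'[of s ?p] s not_prime_unit p by blast
      then have "coprime ?p m" using p prime_imp_coprime by blast
      from closed_imp_shift_invariant[OF closed v m(1) this] have "m = 1"
        using coordinate_shift_invariant[OF \<phi> m(1)] by blast
      then show "\<exists>k. s = ?p ^ k" using m(1) by auto
    qed
    then show ?thesis using s iso wm by auto
  qed
qed

end
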